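(* Let $V:\mathbb{R}^2\to\mathbb{R}$, $V\not\equiv0$, be of class $C^1$ with $V\ge 0$ and $|V(x)|+|x\cdot\nabla V(x)|\le c\,\langle x\rangle^{-\beta}$ for all $x\in\mathbb{R}^2$, for some constants $c>0$ and $\beta>10$. Then zero is not a resonance point of $-\Delta+V$; that is, if $$\Psi=c_0+\Psi_0,\qquad c_0\in\mathbb{C},\quad \Psi_0\in L^q(\mathbb{R}^2)\ \text{for some } q\in(2,\infty),$$ is a solution of $-\Delta\Psi+V\Psi=0$ on $\mathbb{R}^2$, then $\Psi=0$.
   Context: $\langle x\rangle=(1+|x|^2)^{1/2}$; $\Delta$ is the Laplacian on $\mathbb{R}^2$. Zero is a resonance point of $-\Delta+V$ if the equation $-\Delta\Psi+V\Psi=0$ has a nonzero solution of the form $\Psi=c_0+\Psi_0$ with $c_0\in\mathbb{C}$ and $\Psi_0\in L^q(\mathbb{R}^2)$ for some $q\in(2,\infty)$. *)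

theory Defs
  imports "HOL-Analysis.Analysis"
begin

definition japanese_bracket :: "'a::real_normed_vector \<Rightarrow> real" where
  "japanese_bracket x = sqrt (1 + (norm x)\<^sup>2)"

definition partial_deriv ::
    "'a::euclidean_space \<Rightarrow> ('a \<Rightarrow> 'b::real_normed_vector) \<Rightarrow> 'a \<Rightarrow> 'b" where
  "partial_deriv b f x = frechet_derivative f (at x) b"

definition laplacian :: "('a::euclidean_space \<Rightarrow> 'b::real_normed_vector) \<Rightarrow> 'a \<Rightarrow> 'b" where
  "laplacian f x = (\<Sum>b\<in>Basis. partial_deriv b (partial_deriv b f) x)"

text \<open>A function is of class \<open>C\<^sup>\<infinity>\<close> if and only if all its iterated partial derivatives
  exist and are (Frechet) differentiable everywhere; continuity is then automatic.
  The empty list gives differentiability of the function itself.\<close>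

definition smooth :: "('a::euclidean_space \<Rightarrow> 'b::real_normed_vector) \<Rightarrow> bool" where
  "smooth f \<longleftrightarrow>
     (\<forall>bs x. set bs \<subseteq> Basis \<longrightarrow> foldr partial_deriv bs f differentiable (at x))"

text \<open>Test functions are taken real-valued. By linearity this is the same as
  testing against complex-valued ones.\<close>

definition test_function :: "('a::euclidean_space \<Rightarrow> real) \<Rightarrow> bool" where
  "test_function \<phi> \<longleftrightarrow> smooth \<phi> \<and> compact (closure {x. \<phi> x \<noteq> 0})"

definition locally_integrable :: "('a::euclidean_space \<Rightarrow> complex) \<Rightarrow> bool" where
  "locally_integrable f \<longleftrightarrow> (\<forall>K. compact K \<longrightarrow> set_integrable lebesgue K f)"

text \<open>Solutions of \<open>-\<Delta>\<Psi> + V\<Psi> = 0\<close> on the whole space, in the sense of distributions.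
  Both local integrability conditions are automatic when \<open>V\<close> is continuous and \<open>\<Psi>\<close> is a
  constant plus an \<open>L\<^sup>q\<close> function with \<open>q \<ge> 1\<close>; they make the integrals below meaningful
  in general.\<close>

definition schrodinger_solution ::
    "('a::euclidean_space \<Rightarrow> real) \<Rightarrow> ('a \<Rightarrow> complex) \<Rightarrow> bool" where
  "schrodinger_solution V \<Psi> \<longleftrightarrow>
     locally_integrable \<Psi> \<and> locally_integrable (\<lambda>x. V x *\<^sub>R \<Psi> x) \<and>
     (\<forall>\<phi>. test_function \<phi> \<longrightarrow>
        (\<integral>x. (- laplacian \<phi> x + V x * \<phi> x) *\<^sub>R \<Psi> x \<partial>lebesgue) = 0)"

definition in_Lp :: "real \<Rightarrow> ('a::euclidean_space \<Rightarrow> complex) \<Rightarrow> bool" where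
  "in_Lp q f \<longleftrightarrow>
     f \<in> borel_measurable lebesgue \<and> integrable lebesgue (\<lambda>x. norm (f x) powr q)"

text \<open>Elements of \<open>L\<^sup>q\<close> are represented by functions, so a solution is zero when it
  vanishes almost everywhere.\<close>

definition zero_resonance :: "(real ^ 2 \<Rightarrow> real) \<Rightarrow> bool" where
  "zero_resonance V \<longleftrightarrow>
     (\<exists>c\<^sub>0 \<Psi>\<^sub>0 q. 2 < q \<and> in_Lp q \<Psi>\<^sub>0 \<and>
        schrodinger_solution V (\<lambda>x. c\<^sub>0 + \<Psi>\<^sub>0 x) \<and>
        \<not> (AE x in lebesgue. c\<^sub>0 + \<Psi>\<^sub>0 x = 0))"

end

theory Submission
  imports Defs "HOL-Computational_Algebra.Polynomial"
begin

text \<open>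
  Let \<open>u\<close> be the real or imaginary part of a solution \<open>\<Psi> = c\<^sub>0 + \<Psi>\<^sub>0\<close>, so that
  \<open>\<Delta>u = V u\<close> in the sense of distributions. Formally, multiplying by \<open>\<eta>\<^sup>2 u\<close> with a cutoff
  \<open>\<eta>\<close> and integrating by parts gives
  \<open>(1/2) \<integral>\<eta>\<^sup>2 \<bar>\<nabla>u\<bar>\<^sup>2 + \<integral>\<eta>\<^sup>2 V u\<^sup>2 \<le> 2 \<integral>u\<^sup>2 \<bar>\<nabla>\<eta>\<bar>\<^sup>2\<close>.
  As \<open>q > 2\<close>, the function \<open>u\<^sup>2\<close> is at most a constant plus an integrable function. In the plane
  there are logarithmic cutoffs that tend to 1 while both the supremum and the integral of
  \<open>\<bar>\<nabla>\<eta>\<bar>\<^sup>2\<close> tend to zero, so the right-hand side tends to zero. Because \<open>V \<ge> 0\<close>, this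
  forces \<open>\<nabla>u = 0\<close>, hence \<open>u\<close> is a constant \<open>k\<close>; the equation then reads \<open>V k = 0\<close>, and
  \<open>k = 0\<close> because \<open>V\<close> does not vanish identically.

  No regularity theory is used to justify the formal computation. It is carried out for mollifications
  \<open>w = \<rho> * u\<close>, which satisfy \<open>\<Delta>w = \<rho> * (V u)\<close>; on the support of a fixed cutoff, uniform
  continuity of \<open>V\<close> makes \<open>\<rho> * (V u) - V w\<close> small. This is the lemma \<open>mollified_energy_bound\<close>,
  which together with \<open>planar_cutoff_exists\<close> and the weak convergence of mollifications yields
  \<open>test_gradient_vanishes\<close>: the distributional gradient of \<open>u\<close> is zero. That \<open>u\<close> is then constant
  almost everywhere (\<open>vanishing_gradient_imp_constant\<close>) follows from Lebesgue's differentiation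
  theorem, since smooth bumps, and in the limit cubes, have translation invariant averages of \<open>u\<close>.
\<close>

section \<open>Smooth bump functions\<close>

text \<open>The polynomial numerator and the power in the denominator make the family closed under
  differentiation, so that infinite differentiability of \<open>exp (- \<mu> / (1 - t\<^sup>2))\<close>, extended by
  zero, needs only one derivative to be computed. The parameter \<open>\<mu>\<close> is kept because the bumps
  increase to the indicator of \<open>(-1, 1)\<close> as \<open>\<mu> \<rightarrow> 0\<close>.\<close>

definition bump_family :: "real \<Rightarrow> real poly \<Rightarrow> nat \<Rightarrow> real \<Rightarrow> real" where
  "bump_family \<mu> p k t =
     (if \<bar>t\<bar> < 1 then poly p t / (1 - t\<^sup>2) ^ k * exp (- \<mu> / (1 - t\<^sup>2)) else 0)"

lemma exp_minus_inverse_le: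
  fixes s \<mu> :: real
  assumes "0 < s" "0 < \<mu>"
  shows "exp (- \<mu> / s) \<le> fact m / \<mu> ^ m * s ^ m"
proof -
  have "(\<Sum>n\<in>{m}. (\<mu> / s) ^ n /\<^sub>R fact n) \<le> (\<Sum>n. (\<mu> / s) ^ n /\<^sub>R fact n)"
    using assms by (intro sum_le_suminf summable_exp_generic) auto
  hence "(\<mu> / s) ^ m / fact m \<le> exp (\<mu> / s)"
    unfolding exp_def by (simp add: divide_inverse mult.commute)
  hence "1 / exp (\<mu> / s) \<le> 1 / ((\<mu> / s) ^ m / fact m)"
    using assms by (intro divide_left_mono) auto
  thus ?thesis using assms by (simp add: exp_minus field_simps power_divide)
qed

text \<open>The exponential beats every power of \<open>1 / (1 - t\<^sup>2)\<close>. Two spare powers are kept, which forces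
  the derivative to vanish at \<open>t = 1\<close> and \<open>t = -1\<close>.\<close>

lemma bump_family_quadratic_bound:
  assumes "0 < \<mu>"
  shows "\<exists>K. \<forall>t. \<bar>bump_family \<mu> p k t\<bar> \<le> K * (max 0 (1 - t\<^sup>2))\<^sup>2"
proof -
  have "compact {-1..1::real}" by simp
  hence "bounded (poly p ` {-1..1})"
    by (intro compact_imp_bounded compact_continuous_image continuous_on_poly continuous_on_id) simp
  then obtain M where M: "\<And>t. t \<in> {-1..1} \<Longrightarrow> \<bar>poly p t\<bar> \<le> M"
    unfolding bounded_iff by fastforce
  define C where "C = fact (k + 2) / \<mu> ^ (k + 2)"
  have "\<bar>bump_family \<mu> p k t\<bar> \<le> (M * C) * (max 0 (1 - t\<^sup>2))\<^sup>2" for t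
  proof (cases "\<bar>t\<bar> < 1")
    case True
    define s where "s = 1 - t\<^sup>2"
    have s: "0 < s" using True by (simp add: s_def abs_square_less_1)
    have Mt: "\<bar>poly p t\<bar> \<le> M" using True by (intro M) (auto simp: abs_less_iff)
    \<comment> \<open>Taylor's term of order \<open>k + 2\<close> leaves the factor \<open>s\<^sup>2\<close> after division by \<open>s ^ k\<close>.\<close>
    have "\<bar>bump_family \<mu> p k t\<bar> = \<bar>poly p t\<bar> / s ^ k * exp (- \<mu> / s)"
      using True s by (simp add: bump_family_def s_def[symmetric] abs_mult power_abs[symmetric])
    also have "\<dots> \<le> M / s ^ k * (C * s ^ (k + 2))"
      unfolding C_def using s exp_minus_inverse_le[OF s assms, of "k + 2"] Mt order.trans[OF _ Mt]
      by (intro mult_mono divide_right_mono) (auto intro!: divide_nonneg_nonneg)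
    also have "\<dots> = (M * C) * s\<^sup>2"
      using s by (simp add: power_add power2_eq_square)
    finally show ?thesis using s by (simp add: s_def)
  next
    case False
    have "0 \<le> M" using M[of 0] by (auto intro: order_trans[OF abs_ge_zero])
    moreover have "0 \<le> C" using assms by (simp add: C_def)
    ultimately show ?thesis using False by (simp add: bump_family_def)
  qed
  thus ?thesis by blast
qed

definition bump_deriv_poly :: "real \<Rightarrow> real poly \<Rightarrow> nat \<Rightarrow> real poly" where
  "bump_deriv_poly \<mu> p k =
     pderiv p * [:1, 0, -1:] ^ 2 + [:0, 2 * real k:] * p * [:1, 0, -1:] - [:0, 2 * \<mu>:] * p"

lemma bump_family_deriv:
  assumes "0 < \<mu>"
  shows "(bump_family \<mu> p k has_real_derivative
            bump_family \<mu> (bump_deriv_poly \<mu> p k) (k + 2) t) (at t)"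
proof (cases "\<bar>t\<bar> < 1")
  case True
  define s where "s = 1 - t\<^sup>2"
  have s: "0 < s" using True by (simp add: s_def abs_square_less_1)
  have D: "((\<lambda>t. poly p t / (1 - t\<^sup>2) ^ k * exp (- \<mu> / (1 - t\<^sup>2))) has_real_derivative
      (poly (pderiv p) t * s ^ k - poly p t * (real k * s ^ (k - 1) * (- 2 * t))) / (s ^ k * s ^ k)
         * exp (- \<mu> / s)
      + poly p t / s ^ k * (exp (- \<mu> / s) * (- 2 * \<mu> * t / s\<^sup>2))) (at t)"
  proof -
    have ds: "((\<lambda>t. 1 - t\<^sup>2) has_real_derivative - 2 * t) (at t)"
      by (auto intro!: derivative_eq_intros)
    have d1: "((\<lambda>t. poly p t / (1 - t\<^sup>2) ^ k) has_real_derivative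
      (poly (pderiv p) t * s ^ k - poly p t * (real k * s ^ (k - 1) * (- 2 * t))) / (s ^ k * s ^ k)) (at t)"
      unfolding s_def
      by (rule DERIV_divide poly_DERIV DERIV_power[OF ds, THEN DERIV_cong])+
         (use s in \<open>auto simp: s_def\<close>)
    have d2: "((\<lambda>t. - \<mu> / (1 - t\<^sup>2)) has_real_derivative - 2 * \<mu> * t / s\<^sup>2) (at t)"
      by (rule DERIV_divide[OF DERIV_const ds, THEN DERIV_cong])
         (use s in \<open>auto simp: s_def power2_eq_square\<close>)
    show ?thesis
      by (rule DERIV_mult[OF d1 DERIV_chain2[OF DERIV_exp d2], THEN DERIV_cong])
         (simp add: s_def mult.commute)
  qed
  have e: "(poly (pderiv p) t * s ^ k - poly p t * (real k * s ^ (k - 1) * (- 2 * t))) / (s ^ k * s ^ k)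
         * exp (- \<mu> / s)
      + poly p t / s ^ k * (exp (- \<mu> / s) * (- 2 * \<mu> * t / s\<^sup>2))
      = bump_family \<mu> (bump_deriv_poly \<mu> p k) (k + 2) t"
  proof -
    have ps: "poly [:1, 0, -1:] t = s" by (simp add: s_def power2_eq_square)
    have k1: "real k * s ^ (k - 1) = real k * s ^ k / s"
      using s by (cases k) auto
    have "poly (bump_deriv_poly \<mu> p k) t
        = poly (pderiv p) t * s\<^sup>2 + 2 * real k * t * poly p t * s - 2 * \<mu> * t * poly p t"
      unfolding bump_deriv_poly_def poly_add poly_diff poly_mult poly_power ps by simp
    hence "bump_family \<mu> (bump_deriv_poly \<mu> p k) (k + 2) t =
       (poly (pderiv p) t * s\<^sup>2 + 2 * real k * t * poly p t * s - 2 * \<mu> * t * poly p t)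
         / (s ^ k * s\<^sup>2) * exp (- \<mu> / s)"
      using True by (simp add: bump_family_def s_def[symmetric] power_add power2_eq_square[of s])
    moreover have "(A * S - P * (k * S / s * (- 2 * t))) / (S * S) * E + P / S * (E * (- 2 * \<mu> * t / s\<^sup>2))
        = (A * s\<^sup>2 + 2 * k * t * P * s - 2 * \<mu> * t * P) / (S * s\<^sup>2) * E"
      if "S \<noteq> 0" for A S P E k :: real
      using s that by (simp add: divide_simps power2_eq_square) algebra
    ultimately show ?thesis unfolding k1 using s by simp
  qed
  show ?thesis
    by (rule has_field_derivative_transform_within_open[OF D[unfolded e], of "{-1<..<1}"])
       (use True in \<open>auto simp: bump_family_def\<close>)
next
  case False
  obtain K where K: "\<And>x. \<bar>bump_family \<mu> p k x\<bar> \<le> K * (max 0 (1 - x\<^sup>2))\<^sup>2"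
    using bump_family_quadratic_bound[OF assms] by blast
  have K0: "0 \<le> K" using K[of 0] by (simp add: order.trans[OF abs_ge_zero])
  have bnd: "\<bar>bump_family \<mu> p k x\<bar> \<le> (K * (1 + \<bar>x\<bar> + \<bar>t\<bar>)\<^sup>2) * \<bar>x - t\<bar>\<^sup>2" for x
  proof -
    have "1 \<le> t\<^sup>2" using False by (simp add: abs_square_less_1 not_less[symmetric])
    hence "1 - x\<^sup>2 \<le> (t - x) * (t + x)" by (simp add: power2_eq_square algebra_simps)
    also have "\<dots> \<le> \<bar>(t - x) * (t + x)\<bar>" by simp
    also have "\<dots> \<le> \<bar>x - t\<bar> * (1 + \<bar>x\<bar> + \<bar>t\<bar>)"
      unfolding abs_mult by (intro mult_mono) auto
    finally have "(max 0 (1 - x\<^sup>2))\<^sup>2 \<le> (\<bar>x - t\<bar> * (1 + \<bar>x\<bar> + \<bar>t\<bar>))\<^sup>2"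
      by (intro power_mono) (auto intro!: mult_nonneg_nonneg)
    from mult_left_mono[OF this K0] K[of x] show ?thesis
      by (simp add: power_mult_distrib mult_ac)
  qed
  have z: "bump_family \<mu> q j t = 0" for q j using False by (simp add: bump_family_def)
  \<comment> \<open>Since \<open>\<bar>t\<bar> \<ge> 1\<close>, the function vanishes to second order at \<open>t\<close>, from either side.\<close>
  have "((\<lambda>x. (bump_family \<mu> p k x - bump_family \<mu> p k t) / (x - t)) \<longlongrightarrow> 0) (at t)"
  proof (rule Lim_null_comparison)
    show "((\<lambda>x. (K * (1 + \<bar>x\<bar> + \<bar>t\<bar>)\<^sup>2) * \<bar>x - t\<bar>) \<longlongrightarrow> 0) (at t)"
      by (rule tendsto_eq_intros refl | simp)+
    show "\<forall>\<^sub>F x in at t. norm ((bump_family \<mu> p k x - bump_family \<mu> p k t) / (x - t))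
        \<le> (K * (1 + \<bar>x\<bar> + \<bar>t\<bar>)\<^sup>2) * \<bar>x - t\<bar>"
    proof (intro eventually_at_filter[THEN iffD2] always_eventually allI impI)
      fix x assume "x \<noteq> t"
      thus "norm ((bump_family \<mu> p k x - bump_family \<mu> p k t) / (x - t))
        \<le> (K * (1 + \<bar>x\<bar> + \<bar>t\<bar>)\<^sup>2) * \<bar>x - t\<bar>"
        using bnd[of x] by (simp add: z divide_le_eq power2_eq_square mult.assoc)
    qed
  qed
  thus ?thesis unfolding z has_field_derivative_iff by (simp add: z)
qed

text \<open>A partial derivative of a product of functions of the single coordinates replaces one factor by its
  derivative and hence has the same shape. Induction on the number of derivatives then needs no
  Leibniz sums.\<close>

lemma smooth_product:
  fixes S :: "(real \<Rightarrow> real) set"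
  assumes S: "\<And>g. g \<in> S \<Longrightarrow> \<exists>g'\<in>S. \<forall>t. (g has_real_derivative g' t) (at t)"
    and G: "\<And>b. b \<in> Basis \<Longrightarrow> G b \<in> S"
  shows "smooth (\<lambda>x::'a::euclidean_space. a * (\<Prod>b\<in>Basis. G b (x \<bullet> b)))"
proof -
  define P where "P = (\<lambda>f::'a \<Rightarrow> real. \<exists>a G. (\<forall>b\<in>Basis. G b \<in> S) \<and>
      f = (\<lambda>x. a * (\<Prod>b\<in>Basis. G b (x \<bullet> b))))"
  have step: "(\<forall>x. f differentiable at x) \<and> (\<forall>c\<in>Basis. P (partial_deriv c f))" if f: "P f" for f
  proof -
    obtain a G where G: "\<And>b. b \<in> Basis \<Longrightarrow> G b \<in> S"
      and f: "f = (\<lambda>x. a * (\<Prod>b\<in>Basis. G b (x \<bullet> b)))"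
      using f unfolding P_def by blast
    obtain G' where G': "\<And>b. b \<in> Basis \<Longrightarrow> G' b \<in> S"
      "\<And>b t. b \<in> Basis \<Longrightarrow> (G b has_real_derivative G' b t) (at t)"
      using S[OF G] by metis
    have D1: "((\<lambda>x. G b (x \<bullet> b)) has_derivative (\<lambda>v. (v \<bullet> b) * G' b (x \<bullet> b))) (at x)"
      if "b \<in> Basis" for b x
    proof -
      have i: "((\<lambda>x. x \<bullet> b) has_derivative (\<lambda>v. v \<bullet> b)) (at x)"
        by (auto intro!: derivative_eq_intros)
      have "(G b has_derivative (\<lambda>h. h * G' b (x \<bullet> b))) (at (x \<bullet> b))"
        using G'(2)[OF that] by (simp add: has_field_derivative_def mult_commute_abs)
      from has_derivative_compose[OF i this] show ?thesis .
    qed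
    have D: "(f has_derivative (\<lambda>v. a * (\<Sum>i\<in>Basis. (v \<bullet> i) * G' i (x \<bullet> i) *
         (\<Prod>j\<in>Basis - {i}. G j (x \<bullet> j))))) (at x)" for x
      unfolding f by (intro has_derivative_mult_right has_derivative_prod D1)
    have "partial_deriv c f = (\<lambda>x. a * (\<Prod>b\<in>Basis. (G(c := G' c)) b (x \<bullet> b)))"
      if c: "c \<in> Basis" for c
    proof
      fix x
      have "partial_deriv c f x = a * (\<Sum>i\<in>Basis. (c \<bullet> i) * G' i (x \<bullet> i) *
         (\<Prod>j\<in>Basis - {i}. G j (x \<bullet> j)))"
        unfolding partial_deriv_def by (simp add: frechet_derivative_at[OF D[of x], symmetric])
      also have "(\<Sum>i\<in>Basis. (c \<bullet> i) * G' i (x \<bullet> i) * (\<Prod>j\<in>Basis - {i}. G j (x \<bullet> j)))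
         = (\<Sum>i\<in>Basis. if i = c then G' i (x \<bullet> i) * (\<Prod>j\<in>Basis - {i}. G j (x \<bullet> j)) else 0)"
        by (intro sum.cong) (auto simp: inner_Basis c)
      also have "\<dots> = G' c (x \<bullet> c) * (\<Prod>j\<in>Basis - {c}. G j (x \<bullet> j))"
        using c by simp
      also have "\<dots> = (\<Prod>b\<in>Basis. (G(c := G' c)) b (x \<bullet> b))"
        using c by (subst prod.remove[of _ c]) (auto intro!: prod.cong)
      finally show "partial_deriv c f x = a * (\<Prod>b\<in>Basis. (G(c := G' c)) b (x \<bullet> b))" .
    qed
    moreover have "\<forall>b\<in>Basis. (G(c := G' c)) b \<in> S" if "c \<in> Basis" for c
      using G G' that by simp
    ultimately have "P (partial_deriv c f)" if "c \<in> Basis" for c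
      unfolding P_def using that by (intro exI[of _ a] exI[of _ "G(c := G' c)"] conjI)
    thus ?thesis using D unfolding differentiable_def by blast
  qed
  have "P (foldr partial_deriv bs f)" if "set bs \<subseteq> Basis" "P f" for bs f
    using that by (induction bs) (use step in auto)
  moreover have "P (\<lambda>x. a * (\<Prod>b\<in>Basis. G b (x \<bullet> b)))"
    unfolding P_def using G by blast
  ultimately show ?thesis unfolding smooth_def using step by blast
qed

definition box_bump :: "real \<Rightarrow> real \<Rightarrow> 'a::euclidean_space \<Rightarrow> real" where
  "box_bump \<mu> r x = (\<Prod>b\<in>Basis. bump_family \<mu> 1 0 (x \<bullet> b / r))"

lemma smooth_box_bump:
  assumes "0 < \<mu>" "0 < r"
  shows "smooth (\<lambda>x::'a::euclidean_space. a * box_bump \<mu> r x)"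
  unfolding box_bump_def
proof (rule smooth_product[where S = "{\<lambda>t. c * bump_family \<mu> p k (t / r) | c p k. True}"
        and G = "\<lambda>_ t. bump_family \<mu> 1 0 (t / r)"])
  fix g assume "g \<in> {\<lambda>t. c * bump_family \<mu> p k (t / r) | c p k. True}"
  then obtain c p k where g: "g = (\<lambda>t. c * bump_family \<mu> p k (t / r))" by blast
  have "(g has_real_derivative
      (c / r) * bump_family \<mu> (bump_deriv_poly \<mu> p k) (k + 2) (t / r)) (at t)" for t
    unfolding g using assms(2)
    by (auto intro!: derivative_eq_intros DERIV_chain2[OF bump_family_deriv[OF assms(1)]])
  thus "\<exists>g'\<in>{\<lambda>t. c * bump_family \<mu> p k (t / r) | c p k. True}.
       \<forall>t. (g has_real_derivative g' t) (at t)"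
    by (intro bexI[of _ "\<lambda>t. (c / r) * bump_family \<mu> (bump_deriv_poly \<mu> p k) (k + 2) (t / r)"])
       blast+
next
  show "(\<lambda>t. bump_family \<mu> 1 0 (t / r)) \<in> {\<lambda>t. c * bump_family \<mu> p k (t / r) | c p k. True}"
    by (intro CollectI exI[of _ 1] exI[of _ 0]) auto
qed

section \<open>Test functions\<close>

definition supp_in :: "real \<Rightarrow> ('a::real_normed_vector \<Rightarrow> 'b::zero) \<Rightarrow> bool" where
  "supp_in R f \<longleftrightarrow> (\<forall>x. R < norm x \<longrightarrow> f x = 0)"

text \<open>Working with derivatives along a fixed vector makes all the calculus below one-dimensional:
  convolutions only have to be differentiated along lines.\<close>

definition deriv_along :: "'a::real_normed_vector \<Rightarrow> ('a \<Rightarrow> real) \<Rightarrow> ('a \<Rightarrow> real) \<Rightarrow> bool" where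
  "deriv_along v f f' \<longleftrightarrow> (\<forall>x. ((\<lambda>t. f (x + t *\<^sub>R v)) has_real_derivative f' x) (at 0))"

lemma deriv_alongD:
  assumes "deriv_along v f f'"
  shows "((\<lambda>t. f (x + t *\<^sub>R v)) has_real_derivative f' (x + s *\<^sub>R v)) (at s)"
proof -
  have "((\<lambda>t. f ((x + s *\<^sub>R v) + t *\<^sub>R v)) has_real_derivative f' (x + s *\<^sub>R v)) (at 0)"
    using assms unfolding deriv_along_def by blast
  moreover have "(\<lambda>t. f ((x + s *\<^sub>R v) + t *\<^sub>R v)) = (\<lambda>t. f (x + (t + s) *\<^sub>R v))"
    by (simp add: algebra_simps)
  ultimately have "((\<lambda>t. f (x + (t + s) *\<^sub>R v)) has_real_derivative f' (x + s *\<^sub>R v)) (at 0)"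
    by simp
  thus ?thesis using DERIV_shift[of "\<lambda>t. f (x + t *\<^sub>R v)" _ 0 s] by simp
qed

lemma deriv_along_mult:
  assumes "deriv_along v f f'" "deriv_along v g g'"
  shows "deriv_along v (\<lambda>x. f x * g x) (\<lambda>x. f' x * g x + f x * g' x)"
  unfolding deriv_along_def
proof
  fix x
  show "((\<lambda>t. f (x + t *\<^sub>R v) * g (x + t *\<^sub>R v)) has_real_derivative f' x * g x + f x * g' x) (at 0)"
    using DERIV_mult[OF assms[unfolded deriv_along_def, rule_format]] by (simp add: mult.commute)
qed

lemma deriv_along_bound:
  assumes "deriv_along v f f'" "\<And>x. \<bar>f' x\<bar> \<le> M"
  shows "\<bar>f (x + t *\<^sub>R v) - f x\<bar> \<le> M * \<bar>t\<bar>"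
  using field_differentiable_bound[of UNIV "\<lambda>t. f (x + t *\<^sub>R v)" "\<lambda>s. f' (x + s *\<^sub>R v)" M t 0]
    deriv_alongD[OF assms(1)] assms(2) by auto

lemma differentiable_deriv_along:
  fixes \<phi> :: "'a::euclidean_space \<Rightarrow> real"
  assumes "\<And>x. \<phi> differentiable at x"
  shows "deriv_along v \<phi> (\<lambda>x. frechet_derivative \<phi> (at x) v)"
  unfolding deriv_along_def
proof
  fix x
  have "(\<phi> has_derivative frechet_derivative \<phi> (at x)) (at (x + 0 *\<^sub>R v))"
    using assms frechet_derivative_works by auto
  moreover have "((\<lambda>t. x + t *\<^sub>R v) has_derivative (\<lambda>t. t *\<^sub>R v)) (at 0)"
    by (auto intro!: derivative_eq_intros)
  ultimately have "((\<lambda>t. \<phi> (x + t *\<^sub>R v)) has_derivative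
      (\<lambda>t. frechet_derivative \<phi> (at x) (t *\<^sub>R v))) (at 0)"
    by (rule has_derivative_compose[rotated])
  moreover have "linear (frechet_derivative \<phi> (at x))"
    using assms by (rule linear_frechet_derivative)
  ultimately show "((\<lambda>t. \<phi> (x + t *\<^sub>R v)) has_real_derivative frechet_derivative \<phi> (at x) v) (at 0)"
    by (simp add: has_field_derivative_def linear_scale mult_commute_abs)
qed

lemma test_function_differentiable: "test_function \<phi> \<Longrightarrow> \<phi> differentiable at x"
  unfolding test_function_def smooth_def by (metis empty_subsetI foldr.simps(1) id_apply list.set(1))

lemma test_function_continuous: "test_function \<phi> \<Longrightarrow> continuous_on UNIV \<phi>"
  by (auto intro!: continuous_at_imp_continuous_on differentiable_imp_continuous_within
        test_function_differentiable)

lemma test_function_supp_in: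
  fixes \<phi> :: "'a::euclidean_space \<Rightarrow> real"
  assumes "test_function \<phi>"
  obtains R where "0 < R" "supp_in R \<phi>"
proof -
  have "bounded {x. \<phi> x \<noteq> 0}"
    using assms by (simp add: test_function_def)
  then obtain R where "\<forall>x\<in>{x. \<phi> x \<noteq> 0}. norm x \<le> R" "0 < R" by (auto simp: bounded_pos)
  thus ?thesis by (intro that[of R]) (auto simp: supp_in_def not_less[symmetric])
qed

lemma supp_in_partial_deriv:
  fixes \<phi> :: "'a::euclidean_space \<Rightarrow> real"
  assumes "supp_in R \<phi>"
  shows "supp_in R (partial_deriv b \<phi>)"
  unfolding supp_in_def
proof (intro allI impI)
  fix x :: 'a assume "R < norm x"
  moreover have "open {y::'a. R < norm y}"
    by (intro open_Collect_less continuous_intros)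
  ultimately have "(\<phi> has_derivative (\<lambda>_. 0)) (at x)"
    using assms by (intro has_derivative_transform_within_open[OF has_derivative_const[of 0]])
      (auto simp: supp_in_def)
  from frechet_derivative_at[OF this] show "partial_deriv b \<phi> x = 0"
    unfolding partial_deriv_def by metis
qed

lemma supp_in_imp_compact_support:
  fixes \<phi> :: "'a::euclidean_space \<Rightarrow> 'b::zero"
  assumes "supp_in R \<phi>"
  shows "compact (closure {x. \<phi> x \<noteq> 0})"
proof -
  have "{x. \<phi> x \<noteq> 0} \<subseteq> cball 0 R"
    using assms unfolding supp_in_def by (force simp: not_less[symmetric])
  thus ?thesis using bounded_subset[OF bounded_cball] by simp
qed

lemma test_function_partial_deriv:
  fixes \<phi> :: "'a::euclidean_space \<Rightarrow> real"
  assumes "test_function \<phi>" "b \<in> Basis"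
  shows "test_function (partial_deriv b \<phi>)"
proof -
  obtain R where "supp_in R \<phi>" using test_function_supp_in[OF assms(1)] .
  hence "compact (closure {x. partial_deriv b \<phi> x \<noteq> 0})"
    by (intro supp_in_imp_compact_support supp_in_partial_deriv)
  moreover have "smooth (partial_deriv b \<phi>)"
    unfolding smooth_def
  proof (intro allI impI)
    fix bs :: "'a list" and x :: 'a assume "set bs \<subseteq> Basis"
    hence "set (bs @ [b]) \<subseteq> Basis" using assms(2) by simp
    hence "foldr partial_deriv (bs @ [b]) \<phi> differentiable at x"
      using assms(1) unfolding test_function_def smooth_def by blast
    thus "foldr partial_deriv bs (partial_deriv b \<phi>) differentiable at x" by simp
  qed
  ultimately show ?thesis by (simp add: test_function_def)
qed

lemma test_function_deriv_along:
  "test_function \<phi> \<Longrightarrow> deriv_along b \<phi> (partial_deriv b \<phi>)"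
  unfolding partial_deriv_def[abs_def]
  by (intro differentiable_deriv_along test_function_differentiable)

lemma test_function_deriv_along_sum:
  fixes \<phi> :: "'a::euclidean_space \<Rightarrow> real"
  assumes "test_function \<phi>"
  shows "deriv_along v \<phi> (\<lambda>x. \<Sum>b\<in>Basis. (v \<bullet> b) * partial_deriv b \<phi> x)"
proof -
  have "frechet_derivative \<phi> (at x) v = (\<Sum>b\<in>Basis. (v \<bullet> b) * partial_deriv b \<phi> x)" for x
  proof -
    have lin: "linear (frechet_derivative \<phi> (at x))"
      by (intro linear_frechet_derivative test_function_differentiable assms)
    have "frechet_derivative \<phi> (at x) (\<Sum>b\<in>Basis. (v \<bullet> b) *\<^sub>R b)
        = (\<Sum>b\<in>Basis. (v \<bullet> b) * partial_deriv b \<phi> x)"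
      unfolding partial_deriv_def by (simp add: linear_sum[OF lin] linear_scale[OF lin])
    thus ?thesis by (simp add: euclidean_representation)
  qed
  thus ?thesis
    using differentiable_deriv_along[OF test_function_differentiable[OF assms], of v] by simp
qed

lemma partial_deriv_reflect:
  fixes f :: "'a::euclidean_space \<Rightarrow> real"
  assumes "\<And>x. f differentiable at x"
  shows "partial_deriv b (\<lambda>y. a * f (x - y)) = (\<lambda>y. - a * partial_deriv b f (x - y))"
proof
  fix y
  have "(f has_derivative frechet_derivative f (at (x - y))) (at (x - y))"
    using assms frechet_derivative_works by blast
  moreover have "((\<lambda>y. x - y) has_derivative (\<lambda>v. - v)) (at y)"
    by (auto intro!: derivative_eq_intros)
  ultimately have "((\<lambda>y. f (x - y)) has_derivative (\<lambda>v. frechet_derivative f (at (x - y)) (- v))) (at y)"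
    by (rule has_derivative_compose[rotated])
  hence "((\<lambda>y. a * f (x - y)) has_derivative (\<lambda>v. a * frechet_derivative f (at (x - y)) (- v))) (at y)"
    by (rule has_derivative_mult_right)
  moreover have "linear (frechet_derivative f (at (x - y)))"
    using assms by (rule linear_frechet_derivative)
  ultimately show "partial_deriv b (\<lambda>y. a * f (x - y)) y = - a * partial_deriv b f (x - y)"
    by (simp add: partial_deriv_def frechet_derivative_at[symmetric] linear_neg)
qed

lemma test_function_reflect:
  fixes \<phi> :: "'a::euclidean_space \<Rightarrow> real"
  assumes "test_function \<phi>"
  shows "test_function (\<lambda>y. \<phi> (x - y))"
proof -
  obtain R where R: "supp_in R \<phi>" using test_function_supp_in[OF assms] .
  have "supp_in (norm x + R) (\<lambda>y. \<phi> (x - y))"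
    unfolding supp_in_def
  proof (intro allI impI)
    fix y :: 'a assume "norm x + R < norm y"
    hence "R < norm (x - y)" using norm_triangle_ineq2[of y x] by (simp add: norm_minus_commute)
    thus "\<phi> (x - y) = 0" using R by (simp add: supp_in_def)
  qed
  moreover have "smooth (\<lambda>y. \<phi> (x - y))"
  proof -
    have d: "foldr partial_deriv bs \<phi> differentiable at z" if "set bs \<subseteq> Basis" for bs z
      using assms that unfolding test_function_def smooth_def by blast
    have e: "foldr partial_deriv bs (\<lambda>y. \<phi> (x - y))
        = (\<lambda>y. (- 1) ^ length bs * foldr partial_deriv bs \<phi> (x - y))" if "set bs \<subseteq> Basis" for bs
      using that
    proof (induction bs)
      case (Cons b bs)
      thus ?case by (simp add: partial_deriv_reflect d)
    qed simp
    have "(\<lambda>y. (- 1) ^ length bs * foldr partial_deriv bs \<phi> (x - y)) differentiable at y"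
      if "set bs \<subseteq> Basis" for bs y
    proof -
      have "(\<lambda>y. foldr partial_deriv bs \<phi> (x - y)) differentiable at y"
        by (rule differentiable_compose[of _ "\<lambda>y. x - y"])
          (use d[OF that] in \<open>auto intro!: derivative_intros\<close>)
      thus ?thesis by (intro differentiable_mult) auto
    qed
    thus ?thesis unfolding smooth_def using e by simp
  qed
  ultimately show ?thesis
    unfolding test_function_def by (intro conjI supp_in_imp_compact_support)
qed

lemma laplacian_reflect:
  fixes \<phi> :: "'a::euclidean_space \<Rightarrow> real"
  assumes "test_function \<phi>"
  shows "laplacian (\<lambda>y. \<phi> (x - y)) y = laplacian \<phi> (x - y)"
proof -
  have 1: "partial_deriv b (\<lambda>y. \<phi> (x - y)) = (\<lambda>y. - 1 * partial_deriv b \<phi> (x - y))" for b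
    using partial_deriv_reflect[of \<phi> b 1 x] test_function_differentiable[OF assms] by simp
  have "partial_deriv b (partial_deriv b (\<lambda>y. \<phi> (x - y)))
      = (\<lambda>y. partial_deriv b (partial_deriv b \<phi>) (x - y))" if "b \<in> Basis" for b
    unfolding 1 using test_function_differentiable[OF test_function_partial_deriv[OF assms that]]
    by (subst partial_deriv_reflect) auto
  thus ?thesis by (simp add: laplacian_def)
qed

section \<open>Convolution\<close>

definition conv :: "('a::euclidean_space \<Rightarrow> real) \<Rightarrow> ('a \<Rightarrow> real) \<Rightarrow> 'a \<Rightarrow> real" where
  "conv k g x = (\<integral>y. k (x - y) * g y \<partial>lborel)"

definition loc_int :: "('a::euclidean_space \<Rightarrow> real) \<Rightarrow> bool" where
  "loc_int g \<longleftrightarrow> g \<in> borel_measurable borel \<and>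
     (\<forall>R. integrable lborel (\<lambda>y. indicator (cball 0 R) y * g y))"

lemma supp_in_mono: "supp_in R f \<Longrightarrow> R \<le> R' \<Longrightarrow> supp_in R' f"
  by (auto simp: supp_in_def)

lemma continuous_supp_in_bounded:
  fixes k :: "'a::euclidean_space \<Rightarrow> real"
  assumes "continuous_on UNIV k" "supp_in R k"
  obtains M where "0 \<le> M" "\<And>x. \<bar>k x\<bar> \<le> M"
proof -
  have "bounded (k ` cball 0 R)"
    using assms(1) by (intro compact_imp_bounded compact_continuous_image)
      (auto intro: continuous_on_subset)
  then obtain M where M: "\<And>x. x \<in> cball 0 R \<Longrightarrow> \<bar>k x\<bar> \<le> M" "0 < M"
    unfolding bounded_pos by fastforce
  have "\<bar>k x\<bar> \<le> M" for x
    using M assms(2) unfolding supp_in_def by (cases "norm x \<le> R") auto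
  thus ?thesis using M(2) by (intro that[of M]) auto
qed

lemma loc_int_mult_integrable:
  assumes g: "loc_int g" and k: "k \<in> borel_measurable borel" "supp_in R k" "\<And>y. \<bar>k y\<bar> \<le> M"
  shows "integrable lborel (\<lambda>y. k y * g y)"
proof (rule Bochner_Integration.integrable_bound)
  show "integrable lborel (\<lambda>y. M * (indicator (cball 0 R) y * g y))"
    using g by (auto simp: loc_int_def)
  show "(\<lambda>y. k y * g y) \<in> borel_measurable lborel"
    using g k by (auto simp: loc_int_def)
  show "AE y in lborel. norm (k y * g y) \<le> norm (M * (indicator (cball 0 R) y * g y))"
  proof (rule AE_I2)
    fix y
    have "\<bar>k y * g y\<bar> \<le> \<bar>M\<bar> * \<bar>indicator (cball 0 R) y * g y\<bar>"
    proof (cases "norm y \<le> R")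
      case True
      thus ?thesis using order.trans[OF k(3)[of y] abs_ge_self]
        by (simp add: abs_mult mult_right_mono)
    next
      case False
      thus ?thesis using k(2) by (simp add: supp_in_def)
    qed
    thus "norm (k y * g y) \<le> norm (M * (indicator (cball 0 R) y * g y))"
      by (simp add: abs_mult)
  qed
qed

lemma continuous_mult_loc_int:
  assumes "loc_int g" "continuous_on UNIV k" "supp_in R k"
  shows "integrable lborel (\<lambda>y. k y * g y)"
proof -
  obtain M where "\<And>x. \<bar>k x\<bar> \<le> M" using continuous_supp_in_bounded[OF assms(2,3)] by blast
  thus ?thesis
    by (intro loc_int_mult_integrable[OF assms(1) _ assms(3)] borel_measurable_continuous_onI assms(2))
qed

lemma supp_in_reflect:
  fixes k :: "'a::real_normed_vector \<Rightarrow> 'b::zero"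
  assumes "supp_in R k"
  shows "supp_in (R + norm x) (\<lambda>y. k (x - y))"
  unfolding supp_in_def
proof (intro allI impI)
  fix y :: 'a assume "R + norm x < norm y"
  hence "R < norm (x - y)" using norm_triangle_ineq2[of y x] by (simp add: norm_minus_commute)
  thus "k (x - y) = 0" using assms by (simp add: supp_in_def)
qed

lemma conv_integrable:
  assumes "loc_int g" "continuous_on UNIV k" "supp_in R k"
  shows "integrable lborel (\<lambda>y. k (x - y) * g y)"
  by (rule continuous_mult_loc_int[OF assms(1) _ supp_in_reflect[OF assms(3)]])
    (auto intro!: continuous_intros continuous_on_compose2[OF assms(2)])

lemma conv_measurable_integrand:
  assumes "loc_int g" "continuous_on UNIV k"
  shows "(\<lambda>y. k (x - y) * g y) \<in> borel_measurable lborel"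
proof -
  have "continuous_on UNIV (\<lambda>y. k (x - y))"
    by (auto intro!: continuous_intros continuous_on_compose2[OF assms(2)])
  from borel_measurable_continuous_onI[OF this] show ?thesis
    using assms(1) unfolding loc_int_def by (intro borel_measurable_times) auto
qed

lemma conv_continuous:
  assumes g: "loc_int g" and k: "continuous_on UNIV k" "supp_in R k"
  shows "continuous_on UNIV (conv k g)"
proof (rule continuous_at_imp_continuous_on, rule ballI)
  fix x :: 'a
  obtain M where M: "0 \<le> M" "\<And>x. \<bar>k x\<bar> \<le> M" using continuous_supp_in_bounded[OF k] by blast
  show "isCont (conv k g) x"
    unfolding continuous_at_sequentially comp_def
  proof (intro allI impI)
    fix X :: "nat \<Rightarrow> 'a" assume X: "X \<longlonglongrightarrow> x"
    then obtain B where B: "\<And>n. norm (X n) \<le> B"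
      using Bseq_def convergentI convergent_imp_Bseq by metis
    show "(\<lambda>n. conv k g (X n)) \<longlonglongrightarrow> conv k g x"
      unfolding conv_def
    proof (rule integral_dominated_convergence)
      show "integrable lborel (\<lambda>y. M * \<bar>indicator (cball 0 (R + B)) y * g y\<bar>)"
        using g by (intro integrable_mult_right integrable_abs) (auto simp: loc_int_def)
      show "AE y in lborel. (\<lambda>n. k (X n - y) * g y) \<longlonglongrightarrow> k (x - y) * g y"
      proof (intro AE_I2 tendsto_mult tendsto_const)
        fix y
        have "isCont k (x - y)" using k(1) by (simp add: continuous_on_eq_continuous_at)
        thus "(\<lambda>n. k (X n - y)) \<longlonglongrightarrow> k (x - y)"
          by (rule isCont_tendsto_compose) (intro tendsto_intros X)
      qed
      show "AE y in lborel. norm (k (X n - y) * g y) \<le> M * \<bar>indicator (cball 0 (R + B)) y * g y\<bar>" for n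
      proof (rule AE_I2)
        fix y
        show "norm (k (X n - y) * g y) \<le> M * \<bar>indicator (cball 0 (R + B)) y * g y\<bar>"
        proof (cases "norm y \<le> R + B")
          case False
          hence "k (X n - y) = 0"
            using supp_in_mono[OF supp_in_reflect[OF k(2), of "X n"], of "R + B"] B[of n]
            by (simp add: supp_in_def)
          thus ?thesis using M by simp
        qed (use M in \<open>simp add: abs_mult mult_right_mono\<close>)
      qed
    qed (rule conv_measurable_integrand[OF g k(1)])+
  qed
qed

text \<open>Dominated convergence for the difference quotients of the kernel, which are bounded by the maximum of
  \<open>k'\<close> and supported in a fixed ball.\<close>

lemma conv_deriv_along:
  assumes g: "loc_int g" and k: "continuous_on UNIV k" "supp_in R k"
    and k': "continuous_on UNIV k'" "supp_in R k'" and d: "deriv_along v k k'"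
  shows "deriv_along v (conv k g) (conv k' g)"
  unfolding deriv_along_def
proof
  fix x
  obtain M where M: "0 \<le> M" "\<And>x. \<bar>k' x\<bar> \<le> M" using continuous_supp_in_bounded[OF k'] by blast
  show "((\<lambda>t. conv k g (x + t *\<^sub>R v)) has_real_derivative conv k' g x) (at 0)"
    unfolding DERIV_def tendsto_at_iff_sequentially comp_def
  proof (intro allI impI)
    fix X :: "nat \<Rightarrow> real" assume X0: "\<forall>i. X i \<in> UNIV - {0}" and X: "X \<longlonglongrightarrow> 0"
    then obtain B where B: "\<And>n. norm (X n) \<le> B"
      using Bseq_def convergentI convergent_imp_Bseq by metis
    define S where "S = R + norm x + B * norm v"
    have eq: "(conv k g (x + (0 + X n) *\<^sub>R v) - conv k g (x + 0 *\<^sub>R v)) / X n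
        = (\<integral>y. (k ((x - y) + X n *\<^sub>R v) - k (x - y)) / X n * g y \<partial>lborel)" for n
    proof -
      have "conv k g (x + (0 + X n) *\<^sub>R v) - conv k g (x + 0 *\<^sub>R v)
          = (\<integral>y. k (x + X n *\<^sub>R v - y) * g y - k (x - y) * g y \<partial>lborel)"
        unfolding conv_def using conv_integrable[OF g k]
        by (subst Bochner_Integration.integral_diff) auto
      also have "\<dots> / X n = (\<integral>y. (k (x + X n *\<^sub>R v - y) * g y - k (x - y) * g y) / X n \<partial>lborel)"
        by simp
      also have "\<dots> = (\<integral>y. (k ((x - y) + X n *\<^sub>R v) - k (x - y)) / X n * g y \<partial>lborel)"
        by (intro Bochner_Integration.integral_cong refl) (simp add: algebra_simps)
      finally show ?thesis .
    qed
    show "(\<lambda>n. (conv k g (x + (0 + X n) *\<^sub>R v) - conv k g (x + 0 *\<^sub>R v)) / X n) \<longlonglongrightarrow> conv k' g x"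
      unfolding eq unfolding conv_def
    proof (rule integral_dominated_convergence)
      show "integrable lborel (\<lambda>y. M * \<bar>indicator (cball 0 S) y * g y\<bar>)"
        using g by (intro integrable_mult_right integrable_abs) (auto simp: loc_int_def)
      show "(\<lambda>y. k' (x - y) * g y) \<in> borel_measurable lborel"
        by (rule conv_measurable_integrand[OF g k'(1)])
      show "(\<lambda>y. (k ((x - y) + X n *\<^sub>R v) - k (x - y)) / X n * g y) \<in> borel_measurable lborel" for n
      proof -
        have "(\<lambda>y. (k ((x - y) + X n *\<^sub>R v) - k (x - y)) / X n) \<in> borel_measurable borel"
          using X0 by (intro borel_measurable_continuous_onI)
            (auto intro!: continuous_intros continuous_on_compose2[OF k(1)])
        hence "(\<lambda>y. (k ((x - y) + X n *\<^sub>R v) - k (x - y)) / X n) \<in> borel_measurable lborel"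
          by simp
        moreover have "g \<in> borel_measurable lborel" using g by (simp add: loc_int_def)
        ultimately show ?thesis by (rule borel_measurable_times)
      qed
      show "AE y in lborel. (\<lambda>n. (k ((x - y) + X n *\<^sub>R v) - k (x - y)) / X n * g y)
          \<longlonglongrightarrow> k' (x - y) * g y"
      proof (intro AE_I2 tendsto_mult tendsto_const)
        fix y
        have "((\<lambda>t. k ((x - y) + t *\<^sub>R v)) has_real_derivative k' (x - y)) (at 0)"
          using d unfolding deriv_along_def by blast
        thus "(\<lambda>n. (k ((x - y) + X n *\<^sub>R v) - k (x - y)) / X n) \<longlonglongrightarrow> k' (x - y)"
          unfolding DERIV_def tendsto_at_iff_sequentially comp_def using X0 X by auto
      qed
      show "AE y in lborel. norm ((k ((x - y) + X n *\<^sub>R v) - k (x - y)) / X n * g y)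
          \<le> M * \<bar>indicator (cball 0 S) y * g y\<bar>" for n
      proof (rule AE_I2)
        fix y
        show "norm ((k ((x - y) + X n *\<^sub>R v) - k (x - y)) / X n * g y)
          \<le> M * \<bar>indicator (cball 0 S) y * g y\<bar>"
        proof (cases "norm y \<le> S")
          case True
          have "\<bar>(k ((x - y) + X n *\<^sub>R v) - k (x - y)) / X n\<bar> \<le> M"
            using deriv_along_bound[OF d M(2), of "x - y" "X n"] X0 by (auto simp: divide_le_eq)
          from mult_right_mono[OF this abs_ge_zero[of "g y"]] show ?thesis
            using True by (simp only: real_norm_def abs_mult) simp
        next
          case False
          have "\<bar>X n\<bar> * norm v \<le> B * norm v" using B[of n] by (intro mult_right_mono) auto
          hence "norm (x + X n *\<^sub>R v) \<le> norm x + B * norm v"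
            by (intro order.trans[OF norm_triangle_ineq]) simp
          hence "k (x + X n *\<^sub>R v - y) = 0"
            using supp_in_mono[OF supp_in_reflect[OF k(2), of "x + X n *\<^sub>R v"], of S] False
            by (simp add: supp_in_def S_def)
          moreover have "0 \<le> B" using B[of 0] norm_ge_zero order.trans by blast
          hence "k (x - y) = 0"
            using supp_in_mono[OF supp_in_reflect[OF k(2), of x], of S] False
            by (simp add: supp_in_def S_def)
          ultimately show ?thesis using M(1) by (simp add: algebra_simps)
        qed
      qed
    qed
  qed
qed

lemma lborel_distr_reflect:
  "distr lborel borel (\<lambda>y. x - y) = (lborel :: 'a::euclidean_space measure)"
  using lborel_affine[of "-1" x] by (simp add: density_1)

lemma integral_reflect:
  fixes f :: "'a::euclidean_space \<Rightarrow> real"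
  assumes "f \<in> borel_measurable borel"
  shows "(\<integral>y. f (x - y) \<partial>lborel) = (\<integral>y. f y \<partial>lborel)"
proof -
  have "(\<integral>y. f y \<partial>lborel) = (\<integral>y. f y \<partial>distr lborel borel (\<lambda>y. x - y))"
    by (simp add: lborel_distr_reflect)
  also have "\<dots> = (\<integral>y. f (x - y) \<partial>lborel)"
    using assms by (subst integral_distr) auto
  finally show ?thesis by simp
qed

lemma nn_integral_reflect:
  fixes f :: "'a::euclidean_space \<Rightarrow> ennreal"
  assumes "f \<in> borel_measurable borel"
  shows "(\<integral>\<^sup>+y. f (x - y) \<partial>lborel) = (\<integral>\<^sup>+y. f y \<partial>lborel)"
proof -
  have "(\<integral>\<^sup>+y. f y \<partial>lborel) = (\<integral>\<^sup>+y. f y \<partial>distr lborel borel (\<lambda>y. x - y))"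
    by (simp add: lborel_distr_reflect)
  also have "\<dots> = (\<integral>\<^sup>+y. f (x - y) \<partial>lborel)"
    using assms by (subst nn_integral_distr) auto
  finally show ?thesis by simp
qed

lemma loc_int_continuous:
  assumes "continuous_on UNIV (g :: 'a::euclidean_space \<Rightarrow> real)"
  shows "loc_int g"
proof -
  have "integrable lborel (\<lambda>y. indicator (cball 0 R) y *\<^sub>R g y)" for R
    by (intro borel_integrable_compact continuous_on_subset[OF assms]) auto
  thus ?thesis using assms by (simp add: loc_int_def borel_measurable_continuous_onI)
qed

lemma continuous_supp_in_integrable:
  assumes "continuous_on UNIV (k :: 'a::euclidean_space \<Rightarrow> real)" "supp_in R k"
  shows "integrable lborel k"
  using continuous_mult_loc_int[OF loc_int_continuous[of "\<lambda>_. 1"] assms] by simp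

text \<open>Integration by parts without boundary term. Convolution with the constant 1 produces the integral
  of the kernel at every point, so its derivative, which is the integral of \<open>k'\<close>, is zero.\<close>

lemma integral_deriv_along_eq_0:
  assumes k: "continuous_on UNIV k" "supp_in R k"
    and k': "continuous_on UNIV k'" "supp_in R k'" and d: "deriv_along v k k'"
  shows "(\<integral>y. k' y \<partial>lborel) = 0"
proof -
  have c: "conv f (\<lambda>_. 1) x = (\<integral>y. f y \<partial>lborel)" if "continuous_on UNIV f" for f and x :: 'a
    using integral_reflect[of f x] that by (simp add: conv_def borel_measurable_continuous_onI)
  have "deriv_along v (conv k (\<lambda>_. 1)) (conv k' (\<lambda>_. 1))"
    by (intro conv_deriv_along[OF _ k k' d] loc_int_continuous continuous_intros)
  hence "((\<lambda>t. \<integral>y. k y \<partial>lborel) has_real_derivative (\<integral>y. k' y \<partial>lborel)) (at 0)"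
    unfolding deriv_along_def c[OF k(1)] c[OF k'(1)] by blast
  thus ?thesis using DERIV_const DERIV_unique by blast
qed

section \<open>Mollifiers\<close>

lemma box_bump_nonneg: "0 \<le> box_bump \<mu> r x"
  unfolding box_bump_def
  by (intro prod_nonneg) (auto simp: bump_family_def)

lemma box_bump_le_1:
  assumes "0 < \<mu>"
  shows "box_bump \<mu> r x \<le> 1"
  unfolding box_bump_def
proof (intro prod_le_1 conjI)
  fix b :: 'a
  show "0 \<le> bump_family \<mu> 1 0 (x \<bullet> b / r)" by (simp add: bump_family_def)
  show "bump_family \<mu> 1 0 (x \<bullet> b / r) \<le> 1"
  proof (cases "\<bar>x \<bullet> b / r\<bar> < 1")
    case True
    hence "(x \<bullet> b / r)\<^sup>2 < 1" by (simp only: abs_square_less_1)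
    thus ?thesis using assms True by (simp add: bump_family_def)
  qed (simp add: bump_family_def)
qed

lemma box_bump_eq_0:
  assumes "0 < r" "b \<in> Basis" "r \<le> \<bar>x \<bullet> b\<bar>"
  shows "box_bump \<mu> r x = 0"
proof -
  have "bump_family \<mu> 1 0 (x \<bullet> b / r) = 0"
    using assms by (simp add: bump_family_def abs_divide)
  thus ?thesis using assms(2) by (auto simp: box_bump_def)
qed

lemma supp_in_box_bump:
  fixes r :: real
  assumes "0 < r"
  shows "supp_in (r * DIM('a)) (box_bump \<mu> r :: 'a::euclidean_space \<Rightarrow> real)"
  unfolding supp_in_def
proof (intro allI impI)
  fix x :: 'a assume x: "r * DIM('a) < norm x"
  have "\<exists>b\<in>Basis. r \<le> \<bar>x \<bullet> b\<bar>"
  proof (rule ccontr)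
    assume "\<not> ?thesis"
    hence "(\<Sum>b\<in>Basis. \<bar>x \<bullet> b\<bar>) \<le> (\<Sum>b\<in>(Basis::'a set). r)" by (intro sum_mono) auto
    thus False using x norm_le_l1[of x] by (simp add: mult.commute)
  qed
  thus "box_bump \<mu> r x = 0" using box_bump_eq_0[OF assms] by blast
qed

lemma test_function_box_bump:
  assumes "0 < \<mu>" "0 < r"
  shows "test_function (\<lambda>x::'a::euclidean_space. a * box_bump \<mu> r x)"
proof -
  have "supp_in (r * DIM('a)) (\<lambda>x::'a. a * box_bump \<mu> r x)"
    using supp_in_box_bump[OF assms(2), where 'a = 'a] by (auto simp: supp_in_def)
  thus ?thesis unfolding test_function_def
    by (intro conjI smooth_box_bump assms supp_in_imp_compact_support)
qed

lemma integral_continuous_pos: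
  fixes f :: "'a::euclidean_space \<Rightarrow> real"
  assumes f: "continuous_on UNIV f" "supp_in R f" and nonneg: "\<And>x. 0 \<le> f x" and "0 < f x0"
  shows "0 < (\<integral>x. f x \<partial>lborel)"
proof -
  have int: "integrable lborel f" using continuous_supp_in_integrable[OF f] .
  define U where "U = {x. 0 < f x}"
  have U: "open U" "U \<noteq> {}"
    using \<open>0 < f x0\<close> unfolding U_def by (auto intro!: open_Collect_less f(1) continuous_intros)
  have "(\<integral>x. f x \<partial>lborel) \<noteq> 0"
  proof
    assume "(\<integral>x. f x \<partial>lborel) = 0"
    hence "AE x in lborel. f x = 0"
      using integral_nonneg_eq_0_iff_AE[OF int] nonneg by simp
    hence "AE x in lborel. x \<notin> U" by eventually_elim (simp add: U_def)
    hence "U \<in> null_sets lborel" using U by (subst (asm) AE_iff_null_sets[symmetric]) auto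
    hence "U \<in> null_sets lebesgue" by (rule null_sets_completionI)
    hence "negligible U" by (simp add: negligible_iff_null_sets)
    thus False using open_not_negligible U by blast
  qed
  moreover have "0 \<le> (\<integral>x. f x \<partial>lborel)" using nonneg by (intro integral_nonneg_AE) auto
  ultimately show ?thesis by linarith
qed

definition mollifier :: "real \<Rightarrow> ('a::euclidean_space \<Rightarrow> real) \<Rightarrow> bool" where
  "mollifier \<epsilon> \<rho> \<longleftrightarrow> test_function \<rho> \<and> supp_in \<epsilon> \<rho> \<and> (\<forall>x. 0 \<le> \<rho> x) \<and> (\<integral>x. \<rho> x \<partial>lborel) = 1"

lemma mollifier_exists:
  assumes "0 < \<epsilon>"
  shows "\<exists>\<rho> :: 'a::euclidean_space \<Rightarrow> real. mollifier \<epsilon> \<rho>"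
proof -
  define r where "r = \<epsilon> / DIM('a)"
  have r: "0 < r" using assms by (simp add: r_def)
  let ?B = "box_bump 1 r :: 'a \<Rightarrow> real"
  have t: "test_function (\<lambda>x. a * ?B x)" for a
    using r by (intro test_function_box_bump) auto
  have s: "supp_in \<epsilon> ?B" using supp_in_box_bump[OF r, where 'a = 'a] by (simp add: r_def)
  have "0 < ?B 0" by (auto simp: box_bump_def bump_family_def intro!: prod_pos)
  hence I: "0 < (\<integral>x. ?B x \<partial>lborel)"
    using test_function_continuous[OF t[of 1]] s box_bump_nonneg
    by (intro integral_continuous_pos[of _ \<epsilon> 0]) auto
  define a where "a = 1 / (\<integral>x. ?B x \<partial>lborel)"
  have "mollifier \<epsilon> (\<lambda>x. a * ?B x)"
    unfolding mollifier_def
  proof (intro conjI allI)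
    show "(\<integral>x. a * ?B x \<partial>lborel) = 1" using I by (simp add: a_def)
    show "0 \<le> a * ?B x" for x
      using I box_bump_nonneg[of 1 r x] by (simp add: a_def)
    show "supp_in \<epsilon> (\<lambda>x. a * ?B x)" using s by (simp add: supp_in_def)
  qed (rule t)
  thus ?thesis by blast
qed

lemma mollifierD:
  assumes "mollifier \<epsilon> \<rho>"
  shows "test_function \<rho>" "supp_in \<epsilon> \<rho>" "0 \<le> \<rho> x" "continuous_on UNIV \<rho>"
    "(\<integral>x. \<rho> x \<partial>lborel) = 1"
  using assms test_function_continuous by (auto simp: mollifier_def)

lemma loc_int_integrable: "integrable lborel h \<Longrightarrow> loc_int h"
  unfolding loc_int_def using integrable_mult_indicator[of "cball 0 _" lborel h] by auto

lemma loc_int_add: "loc_int f \<Longrightarrow> loc_int g \<Longrightarrow> loc_int (\<lambda>x. f x + g x)"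
  unfolding loc_int_def by (auto simp: distrib_left)

lemma loc_int_bound:
  assumes "loc_int f" "g \<in> borel_measurable borel" "\<And>x. \<bar>g x\<bar> \<le> f x"
  shows "loc_int g"
  unfolding loc_int_def
proof (intro conjI allI)
  fix R :: real
  have "integrable lborel (\<lambda>y. indicator (cball 0 R) y * f y)" using assms(1) by (simp add: loc_int_def)
  thus "integrable lborel (\<lambda>y. indicator (cball 0 R) y * g y)"
    by (rule Bochner_Integration.integrable_bound)
      (use assms(2,3) in \<open>auto simp: abs_mult indicator_def intro: order.trans[OF assms(3) abs_ge_self]\<close>)
qed (rule assms)

lemma loc_int_abs: "loc_int g \<Longrightarrow> loc_int (\<lambda>x. \<bar>g x\<bar>)"
  unfolding loc_int_def
proof safe
  fix R :: real assume "\<forall>R. integrable lborel (\<lambda>y. indicat_real (cball 0 R) y * g y)"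
  hence "integrable lborel (\<lambda>y. \<bar>indicat_real (cball 0 R) y * g y\<bar>)" by (intro integrable_abs) auto
  thus "integrable lborel (\<lambda>y. indicat_real (cball 0 R) y * \<bar>g y\<bar>)" by (simp add: abs_mult)
qed auto

lemma loc_int_continuous_mult:
  assumes "loc_int g" "continuous_on UNIV V"
  shows "loc_int (\<lambda>x. V x * g x)"
  unfolding loc_int_def
proof (intro conjI allI)
  have V: "V \<in> borel_measurable borel" using assms(2) by (rule borel_measurable_continuous_onI)
  show "(\<lambda>x. V x * g x) \<in> borel_measurable borel" using V assms(1) unfolding loc_int_def by (intro borel_measurable_times) auto
  fix R :: real
  have "bounded (V ` cball 0 R)"
    using assms(2) by (intro compact_imp_bounded compact_continuous_image)
      (auto intro: continuous_on_subset)
  then obtain M where M: "\<And>x. x \<in> cball 0 R \<Longrightarrow> \<bar>V x\<bar> \<le> M" "0 < M"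
    unfolding bounded_pos by fastforce
  have "integrable lborel (\<lambda>y. (indicator (cball 0 R) y * V y) * g y)"
    using M V by (intro loc_int_mult_integrable[OF assms(1), of _ R M])
      (auto simp: supp_in_def indicator_def)
  thus "integrable lborel (\<lambda>y. indicator (cball 0 R) y * (V y * g y))" by (simp add: mult.assoc)
qed

lemma conv_mono:
  assumes "mollifier \<epsilon> \<rho>" "loc_int f" "loc_int g" "\<And>y. norm (x - y) \<le> \<epsilon> \<Longrightarrow> f y \<le> g y"
  shows "conv \<rho> f x \<le> conv \<rho> g x"
  unfolding conv_def
proof (intro integral_mono conv_integrable[OF _ mollifierD(4,2)[OF assms(1)]] assms(2,3))
  fix y
  show "\<rho> (x - y) * f y \<le> \<rho> (x - y) * g y"
    using mollifierD(2,3)[OF assms(1)] assms(4)[of y]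
    by (cases "norm (x - y) \<le> \<epsilon>") (auto simp: supp_in_def intro!: mult_left_mono)
qed

lemma conv_add:
  assumes "loc_int f" "loc_int g" "continuous_on UNIV k" "supp_in R k"
  shows "conv k (\<lambda>y. f y + g y) x = conv k f x + conv k g x"
  unfolding conv_def distrib_left
  using conv_integrable[OF _ assms(3,4)] assms(1,2) by (intro Bochner_Integration.integral_add)

lemma conv_cmult: "conv k (\<lambda>y. c * f y) x = c * conv k f x"
  unfolding conv_def by (simp add: mult.left_commute)

lemma conv_const:
  assumes "mollifier \<epsilon> \<rho>"
  shows "conv \<rho> (\<lambda>_. c) x = c"
  using integral_reflect[of \<rho> x] mollifierD(4,5)[OF assms]
  by (simp add: conv_def borel_measurable_continuous_onI)

text \<open>Jensen's inequality for the probability density \<open>\<rho>\<close>, obtained by averaging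
  \<open>(g - s)\<^sup>2 \<ge> 0\<close> with \<open>s\<close> the mean value.\<close>

lemma conv_square_le:
  assumes \<rho>: "mollifier \<epsilon> \<rho>" and g: "loc_int g" "loc_int (\<lambda>y. (g y)\<^sup>2)"
  shows "(conv \<rho> g x)\<^sup>2 \<le> conv \<rho> (\<lambda>y. (g y)\<^sup>2) x"
proof -
  define s where "s = conv \<rho> g x"
  have c: "loc_int (\<lambda>_::'a. c)" for c by (intro loc_int_continuous continuous_intros)
  have l: "loc_int (\<lambda>y. (- 2 * s) * g y)"
    by (intro loc_int_continuous_mult g continuous_intros)
  note add = conv_add[OF _ _ mollifierD(4,2)[OF \<rho>]]
  have "conv \<rho> (\<lambda>_. 0) x \<le> conv \<rho> (\<lambda>y. ((g y)\<^sup>2 + (- 2 * s) * g y) + s\<^sup>2) x"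
  proof (rule conv_mono[OF \<rho>])
    fix y
    have "0 \<le> (g y - s)\<^sup>2" by simp
    thus "0 \<le> ((g y)\<^sup>2 + (- 2 * s) * g y) + s\<^sup>2" by (simp add: power2_diff algebra_simps)
  qed (intro loc_int_add c g l)+
  also have "\<dots> = conv \<rho> (\<lambda>y. (g y)\<^sup>2) x + (- 2 * s) * conv \<rho> g x + s\<^sup>2"
    by (subst add add[OF g(2) l] conv_cmult conv_const[OF \<rho>] | intro loc_int_add c g l refl)+
  finally show ?thesis unfolding conv_const[OF \<rho>] s_def[symmetric]
    by (simp add: power2_eq_square)
qed

lemma integral_conv:
  assumes \<rho>: "mollifier \<epsilon> \<rho>" and h: "integrable lborel h" "\<And>x. 0 \<le> h x"
  shows "integrable lborel (conv \<rho> h)" "(\<integral>x. conv \<rho> h x \<partial>lborel) = (\<integral>x. h x \<partial>lborel)"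
    "\<And>x. 0 \<le> conv \<rho> h x"
proof -
  note \<rho>D = mollifierD[OF \<rho>]
  have li: "loc_int h" using h(1) by (rule loc_int_integrable)
  have hm [measurable]: "h \<in> borel_measurable borel" using h(1) by auto
  have \<rho>m [measurable]: "\<rho> \<in> borel_measurable borel"
    using \<rho>D(4) by (rule borel_measurable_continuous_onI)
  show nonneg: "0 \<le> conv \<rho> h x" for x
    unfolding conv_def using \<rho>D h by (intro integral_nonneg_AE) auto
  have "(\<integral>\<^sup>+x. ennreal (conv \<rho> h x) \<partial>lborel)
      = (\<integral>\<^sup>+x. (\<integral>\<^sup>+y. ennreal (\<rho> (x - y) * h y) \<partial>lborel) \<partial>lborel)"
    unfolding conv_def
    by (intro nn_integral_cong nn_integral_eq_integral[symmetric] conv_integrable[OF li \<rho>D(4,2)])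
       (use \<rho>D h in auto)
  also have "\<dots> = (\<integral>\<^sup>+y. (\<integral>\<^sup>+x. ennreal (\<rho> (x - y) * h y) \<partial>lborel) \<partial>lborel)"
    by (rule lborel_pair.Fubini') measurable
  also have "\<dots> = (\<integral>\<^sup>+y. ennreal (h y) \<partial>lborel)"
  proof (rule nn_integral_cong)
    fix y
    have "(\<integral>\<^sup>+x. ennreal (\<rho> (x - y) * h y) \<partial>lborel)
        = (\<integral>\<^sup>+x. ennreal (\<rho> (x - y)) * ennreal (h y) \<partial>lborel)"
      using \<rho>D h by (simp add: ennreal_mult)
    also have "\<dots> = (\<integral>\<^sup>+x. ennreal (\<rho> (x - y)) \<partial>lborel) * ennreal (h y)"
      by (rule nn_integral_multc) measurable
    also have "(\<integral>\<^sup>+x. ennreal (\<rho> (x - y)) \<partial>lborel) = (\<integral>\<^sup>+z. ennreal (\<rho> z) \<partial>lborel)"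
      using nn_integral_reflect[of "\<lambda>z. ennreal (\<rho> (- z))" y]
        nn_integral_reflect[of "\<lambda>z. ennreal (\<rho> z)" 0] by simp
    also have "\<dots> = 1"
      using \<rho>D by (subst nn_integral_eq_integral) (auto intro: continuous_supp_in_integrable)
    finally show "(\<integral>\<^sup>+x. ennreal (\<rho> (x - y) * h y) \<partial>lborel) = ennreal (h y)" by simp
  qed
  also have "\<dots> = ennreal (\<integral>x. h x \<partial>lborel)"
    using h by (intro nn_integral_eq_integral) auto
  finally have e: "(\<integral>\<^sup>+x. ennreal (conv \<rho> h x) \<partial>lborel) = ennreal (\<integral>x. h x \<partial>lborel)" .
  have m: "conv \<rho> h \<in> borel_measurable lborel"
    using borel_measurable_continuous_onI[OF conv_continuous[OF li \<rho>D(4,2)]] by simp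
  show i: "integrable lborel (conv \<rho> h)"
    using m nonneg e by (intro integrableI_nonneg) auto
  have "0 \<le> (\<integral>x. conv \<rho> h x \<partial>lborel)" "0 \<le> (\<integral>x. h x \<partial>lborel)"
    using nonneg h(2) by (auto intro!: integral_nonneg_AE)
  thus "(\<integral>x. conv \<rho> h x \<partial>lborel) = (\<integral>x. h x \<partial>lborel)"
    using e nonneg by (subst (asm) nn_integral_eq_integral[OF i]) auto
qed

lemma conv_transpose:
  assumes k: "continuous_on UNIV k" "supp_in r k" and \<psi>: "continuous_on UNIV \<psi>" "supp_in R \<psi>"
    and g: "loc_int g"
  shows "(\<integral>x. conv k g x * \<psi> x \<partial>lborel) = (\<integral>y. (\<integral>x. k (x - y) * \<psi> x \<partial>lborel) * g y \<partial>lborel)"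
    "integrable lborel (\<lambda>y. (\<integral>x. k (x - y) * \<psi> x \<partial>lborel) * g y)"
proof -
  obtain M where M: "0 \<le> M" "\<And>x. \<bar>k x\<bar> \<le> M" using continuous_supp_in_bounded[OF k] by blast
  have [measurable]: "k \<in> borel_measurable borel" "\<psi> \<in> borel_measurable borel" "g \<in> borel_measurable borel"
    using k \<psi> g by (auto simp: loc_int_def borel_measurable_continuous_onI)
  let ?A = "\<lambda>x. M * \<psi> x" and ?B = "\<lambda>y. indicator (cball 0 (R + r)) y * g y"
  have B: "integrable lborel ?B" using g by (simp add: loc_int_def)
  have [measurable]: "?B \<in> borel_measurable borel" using borel_measurable_integrable[OF B] by simp
  have A: "integrable lborel ?A" using continuous_supp_in_integrable[OF \<psi>] by simp
  have AB: "integrable (lborel \<Otimes>\<^sub>M lborel) (\<lambda>(x, y). ?A x * ?B y)"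
  proof (rule lborel_pair.Fubini_integrable)
    show "(\<lambda>(x, y). ?A x * ?B y) \<in> borel_measurable (lborel \<Otimes>\<^sub>M lborel)" by measurable
    have "(\<lambda>x. \<integral>y. norm (?A x * ?B y) \<partial>lborel) = (\<lambda>x. \<bar>?A x\<bar> * (\<integral>y. \<bar>?B y\<bar> \<partial>lborel))"
      by (simp add: abs_mult mult.assoc)
    thus "integrable lborel (\<lambda>x. \<integral>y. norm (case (x, y) of (x, y) \<Rightarrow> ?A x * ?B y) \<partial>lborel)"
      using integrable_mult_left[OF integrable_abs[OF A]] by simp
    show "AE x in lborel. integrable lborel (\<lambda>y. case (x, y) of (x, y) \<Rightarrow> ?A x * ?B y)"
      using integrable_mult_right[OF B] by (intro AE_I2) (simp del: integrable_mult_right_iff)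
  qed
  have I: "integrable (lborel \<Otimes>\<^sub>M lborel) (\<lambda>(x, y). k (x - y) * g y * \<psi> x)"
  proof (rule Bochner_Integration.integrable_bound[OF AB])
    show "(\<lambda>(x, y). k (x - y) * g y * \<psi> x) \<in> borel_measurable (lborel \<Otimes>\<^sub>M lborel)" by measurable
    have "\<bar>k (x - y) * g y * \<psi> x\<bar> \<le> \<bar>?A x * ?B y\<bar>" for x y
    proof (cases "norm (x - y) \<le> r \<and> norm x \<le> R")
      case True
      hence "norm y \<le> R + r" using norm_triangle_ineq2[of y x] by (simp add: norm_minus_commute)
      moreover have "\<bar>k (x - y)\<bar> * (\<bar>g y\<bar> * \<bar>\<psi> x\<bar>) \<le> M * (\<bar>g y\<bar> * \<bar>\<psi> x\<bar>)"
        using M by (intro mult_right_mono) auto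
      ultimately show ?thesis using M(1) by (simp add: abs_mult mult_ac)
    next
      case False
      hence "k (x - y) = 0 \<or> \<psi> x = 0" using k(2) \<psi>(2) by (auto simp: supp_in_def)
      thus ?thesis by auto
    qed
    thus "AE p in lborel \<Otimes>\<^sub>M lborel. norm (case p of (x, y) \<Rightarrow> k (x - y) * g y * \<psi> x)
        \<le> norm (case p of (x, y) \<Rightarrow> ?A x * ?B y)"
      by (intro AE_I2) (auto simp: case_prod_beta)
  qed
  have c: "(\<lambda>y. \<integral>x. k (x - y) * g y * \<psi> x \<partial>lborel) = (\<lambda>y. (\<integral>x. k (x - y) * \<psi> x \<partial>lborel) * g y)"
  proof
    fix y
    have "(\<integral>x. k (x - y) * g y * \<psi> x \<partial>lborel) = (\<integral>x. (k (x - y) * \<psi> x) * g y \<partial>lborel)"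
      by (intro Bochner_Integration.integral_cong) (auto simp: mult_ac)
    thus "(\<integral>x. k (x - y) * g y * \<psi> x \<partial>lborel) = (\<integral>x. k (x - y) * \<psi> x \<partial>lborel) * g y"
      by simp
  qed
  have "(\<integral>x. conv k g x * \<psi> x \<partial>lborel) = (\<integral>x. (\<integral>y. k (x - y) * g y * \<psi> x \<partial>lborel) \<partial>lborel)"
    by (simp add: conv_def)
  also have "\<dots> = (\<integral>y. (\<integral>x. k (x - y) * g y * \<psi> x \<partial>lborel) \<partial>lborel)"
    by (rule lborel_pair.Fubini_integral[OF I, symmetric])
  finally show "(\<integral>x. conv k g x * \<psi> x \<partial>lborel) = (\<integral>y. (\<integral>x. k (x - y) * \<psi> x \<partial>lborel) * g y \<partial>lborel)"
    unfolding c .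
  show "integrable lborel (\<lambda>y. (\<integral>x. k (x - y) * \<psi> x \<partial>lborel) * g y)"
    using lborel_pair.integrable_snd[OF I] unfolding c .
qed

lemma abs_integral_le:
  fixes f :: "'a \<Rightarrow> real"
  assumes "integrable M g" "\<And>x. \<bar>f x\<bar> \<le> g x"
  shows "\<bar>\<integral>x. f x \<partial>M\<bar> \<le> (\<integral>x. g x \<partial>M)"
  using assms by (intro order.trans[OF integral_abs_bound integral_mono_AE'])
    (auto intro: order.trans[OF abs_ge_zero])

text \<open>Only the weak convergence of mollifications is needed, so the kernel can be moved to the continuous
  function \<open>\<psi>\<close>, whose mollifications converge uniformly.\<close>

lemma conv_weak_limit:
  assumes \<psi>: "continuous_on UNIV \<psi>" "supp_in R \<psi>" and g: "loc_int g" and "0 < \<delta>"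
  shows "\<exists>\<epsilon>0>0. \<forall>\<epsilon> \<rho>. \<epsilon> \<le> \<epsilon>0 \<longrightarrow> mollifier \<epsilon> \<rho> \<longrightarrow>
    \<bar>(\<integral>x. conv \<rho> g x * \<psi> x \<partial>lborel) - (\<integral>x. g x * \<psi> x \<partial>lborel)\<bar> \<le> \<delta>"
proof -
  define I where "I = (\<integral>y. indicator (cball 0 (R + 1)) y * \<bar>g y\<bar> \<partial>lborel)"
  have gi: "integrable lborel (\<lambda>y. indicator (cball 0 (R + 1)) y * \<bar>g y\<bar>)"
    using loc_int_abs[OF g] by (simp add: loc_int_def)
  have I: "0 \<le> I" unfolding I_def by (intro integral_nonneg_AE) auto
  define \<eta> where "\<eta> = \<delta> / (I + 1)"
  have \<eta>: "0 < \<eta>" using I \<open>0 < \<delta>\<close> by (simp add: \<eta>_def)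
  have "uniformly_continuous_on (cball 0 (R + 2)) \<psi>"
    using \<psi>(1) by (intro compact_uniformly_continuous) (auto intro: continuous_on_subset)
  then obtain d where d: "0 < d"
    "\<And>x y. norm x \<le> R + 2 \<Longrightarrow> norm y \<le> R + 2 \<Longrightarrow> norm (x - y) < d \<Longrightarrow> \<bar>\<psi> x - \<psi> y\<bar> < \<eta>"
    using \<eta> unfolding uniformly_continuous_on_def dist_norm by (auto simp: norm_minus_commute)
  have "\<bar>(\<integral>x. conv \<rho> g x * \<psi> x \<partial>lborel) - (\<integral>x. g x * \<psi> x \<partial>lborel)\<bar> \<le> \<delta>"
    if \<epsilon>: "\<epsilon> \<le> min 1 (d / 2)" and \<rho>: "mollifier \<epsilon> \<rho>" for \<epsilon> \<rho>
  proof -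
    note \<rho>D = mollifierD[OF \<rho>]
    let ?P = "\<lambda>y. \<integral>x. \<rho> (x - y) * \<psi> x \<partial>lborel"
    have \<rho>i: "continuous_on UNIV (\<lambda>x. \<rho> (- x))" "supp_in \<epsilon> (\<lambda>x. \<rho> (- x))"
      using \<rho>D(2) by (auto intro!: continuous_intros continuous_on_compose2[OF \<rho>D(4)] simp: supp_in_def)
    have mass: "(\<integral>x. \<rho> (x - y) \<partial>lborel) = 1" for y
      using integral_reflect[of "\<lambda>z. \<rho> (- z)" y] integral_reflect[of \<rho> 0] \<rho>D(5)
        borel_measurable_continuous_onI[OF \<rho>i(1)] borel_measurable_continuous_onI[OF \<rho>D(4)] by simp
    have int: "integrable lborel (\<lambda>x. \<rho> (x - y) * f x)" if "continuous_on UNIV f" for y f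
      using conv_integrable[OF loc_int_continuous[OF that] \<rho>i, of y] by simp
    have near: "norm (x - y) < d \<and> norm (x - y) \<le> 1" if "\<rho> (x - y) \<noteq> 0" for x y
      using that \<rho>D(2) \<epsilon> d(1) unfolding supp_in_def by (force simp: not_less[symmetric])
    have osc: "\<bar>?P y - \<psi> y\<bar> \<le> \<eta> * indicator (cball 0 (R + 1)) y" for y
    proof (cases "norm y \<le> R + 1")
      case True
      have "?P y - \<psi> y = (\<integral>x. \<rho> (x - y) * \<psi> x - \<rho> (x - y) * \<psi> y \<partial>lborel)"
        using int[OF \<psi>(1)] int[of "\<lambda>_. \<psi> y"] mass[of y] by simp
      also have "\<bar>\<dots>\<bar> \<le> (\<integral>x. \<rho> (x - y) * \<eta> \<partial>lborel)"
      proof (rule abs_integral_le)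
        fix x
        show "\<bar>\<rho> (x - y) * \<psi> x - \<rho> (x - y) * \<psi> y\<bar> \<le> \<rho> (x - y) * \<eta>"
        proof (cases "\<rho> (x - y) = 0")
          case False
          have "norm x \<le> norm y + norm (x - y)" using norm_triangle_ineq[of y "x - y"] by simp
          hence "\<bar>\<psi> x - \<psi> y\<bar> \<le> \<eta>"
            using d(2)[of x y] near[OF False] True by (intro less_imp_le) auto
          thus ?thesis using \<rho>D(3)[of "x - y"]
            by (simp add: right_diff_distrib[symmetric] abs_mult mult_left_mono)
        qed simp
      qed (intro int continuous_intros)
      also have "\<dots> = (\<integral>x. \<rho> (x - y) \<partial>lborel) * \<eta>" by (rule integral_mult_left_zero)
      also have "\<dots> = \<eta>" using mass[of y] by simp
      finally show ?thesis using True by simp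
    next
      case False
      have "\<rho> (x - y) * \<psi> x = 0" for x
      proof (cases "\<rho> (x - y) = 0")
        case nz: False
        have "norm y \<le> norm x + norm (x - y)"
          using norm_triangle_ineq2[of y x] by (simp add: norm_minus_commute)
        hence "R < norm x" using near[OF nz] False by linarith
        thus ?thesis using \<psi>(2) by (simp add: supp_in_def)
      qed simp
      hence "(\<lambda>x. \<rho> (x - y) * \<psi> x) = (\<lambda>_. 0)" by blast
      hence "?P y = 0" by simp
      thus ?thesis using False \<psi>(2) by (simp add: supp_in_def)
    qed
    have "(\<integral>x. conv \<rho> g x * \<psi> x \<partial>lborel) - (\<integral>x. g x * \<psi> x \<partial>lborel)
       = (\<integral>y. ?P y * g y - \<psi> y * g y \<partial>lborel)"
      unfolding conv_transpose(1)[OF \<rho>D(4,2) \<psi> g]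
      using conv_transpose(2)[OF \<rho>D(4,2) \<psi> g] continuous_mult_loc_int[OF g \<psi>]
      by (simp add: mult.commute)
    also have "\<bar>\<dots>\<bar> \<le> (\<integral>y. \<eta> * (indicator (cball 0 (R + 1)) y * \<bar>g y\<bar>) \<partial>lborel)"
    proof (rule abs_integral_le)
      fix y
      have "\<bar>?P y - \<psi> y\<bar> * \<bar>g y\<bar> \<le> \<eta> * indicator (cball 0 (R + 1)) y * \<bar>g y\<bar>"
        by (intro mult_right_mono osc) auto
      thus "\<bar>?P y * g y - \<psi> y * g y\<bar> \<le> \<eta> * (indicator (cball 0 (R + 1)) y * \<bar>g y\<bar>)"
        by (simp only: left_diff_distrib[symmetric] abs_mult mult.assoc)
    qed (use gi in simp)
    also have "\<dots> = \<eta> * I" unfolding I_def by (rule integral_mult_right_zero)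
    also have "\<dots> \<le> \<delta>" using I \<open>0 < \<delta>\<close> by (simp add: \<eta>_def field_simps)
    finally show ?thesis .
  qed
  thus ?thesis using d(1) by (intro exI[of _ "min 1 (d / 2)"]) auto
qed

section \<open>The energy estimate\<close>

text \<open>The Caccioppoli inequality. The divergence of \<open>\<eta>\<^sup>2 w \<nabla>w\<close> integrates to zero, and its
  cross term \<open>2 \<eta> w g \<cdot> \<nabla>w\<close> is absorbed by completing the square. The field \<open>g\<close> stands for
  \<open>\<nabla>\<eta>\<close>, but only \<open>\<nabla>(\<eta>\<^sup>2) = 2 \<eta> g\<close> is required, which allows
  cutoffs \<open>\<eta>\<close> with a kink where they reach zero.\<close>

lemma energy_estimate:
  fixes \<eta> w F :: "'a::euclidean_space \<Rightarrow> real" and p q g :: "'a \<Rightarrow> 'a \<Rightarrow> real"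
  assumes \<eta>: "continuous_on UNIV \<eta>" "supp_in R \<eta>"
    and g: "\<And>b. b \<in> Basis \<Longrightarrow> continuous_on UNIV (g b)"
      "\<And>b. b \<in> Basis \<Longrightarrow> deriv_along b (\<lambda>x. (\<eta> x)\<^sup>2) (\<lambda>x. 2 * \<eta> x * g b x)"
    and w: "continuous_on UNIV w"
    and p: "\<And>b. b \<in> Basis \<Longrightarrow> continuous_on UNIV (p b)" "\<And>b. b \<in> Basis \<Longrightarrow> deriv_along b w (p b)"
    and q: "\<And>b. b \<in> Basis \<Longrightarrow> continuous_on UNIV (q b)" "\<And>b. b \<in> Basis \<Longrightarrow> deriv_along b (p b) (q b)"
    and F: "\<And>x. F x = (\<Sum>b\<in>Basis. q b x)"
  shows "(1 / 2) * (\<integral>x. (\<eta> x)\<^sup>2 * (\<Sum>b\<in>Basis. (p b x)\<^sup>2) \<partial>lborel)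
     \<le> (\<integral>x. 2 * (w x)\<^sup>2 * (indicator (cball 0 R) x * (\<Sum>b\<in>Basis. (g b x)\<^sup>2)) \<partial>lborel)
       - (\<integral>x. (\<eta> x)\<^sup>2 * w x * F x \<partial>lborel)"
proof -
  let ?T = "\<lambda>b x. 2 * \<eta> x * g b x * (w x * p b x) + (\<eta> x)\<^sup>2 * (p b x * p b x + w x * q b x)"
  have eta0: "\<eta> x = 0" if "R < norm x" for x :: 'a using \<eta>(2) that by (simp add: supp_in_def)
  note cont = \<eta>(1) g(1) w p(1) q(1)
  have int: "integrable lborel f" if "continuous_on UNIV f" "\<And>x. \<eta> x = 0 \<Longrightarrow> f x = 0" for f :: "'a \<Rightarrow> real"
    using that eta0 by (intro continuous_supp_in_integrable[of f R]) (auto simp: supp_in_def)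
  have T0: "(\<integral>x. ?T b x \<partial>lborel) = 0" if b: "b \<in> Basis" for b
  proof (rule integral_deriv_along_eq_0[where k = "\<lambda>x. (\<eta> x)\<^sup>2 * (w x * p b x)" and R = R])
    show "deriv_along b (\<lambda>x. (\<eta> x)\<^sup>2 * (w x * p b x)) (?T b)"
      using b by (intro deriv_along_mult g p q)
  qed (use b eta0 in \<open>auto intro!: continuous_intros cont simp: supp_in_def\<close>)
  have intT: "integrable lborel (?T b)" if "b \<in> Basis" for b
    using that by (intro int) (auto intro!: continuous_intros cont)
  have i1: "integrable lborel (\<lambda>x. (\<eta> x)\<^sup>2 * (\<Sum>b\<in>Basis. (p b x)\<^sup>2))"
    by (intro int) (auto intro!: continuous_intros cont)
  have "continuous_on UNIV (\<lambda>x. (\<eta> x)\<^sup>2 * w x * F x)"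
    unfolding F by (intro continuous_intros cont)
  hence i2: "integrable lborel (\<lambda>x. (\<eta> x)\<^sup>2 * w x * F x)" by (intro int) auto
  have i3: "integrable lborel (\<lambda>x. 2 * (w x)\<^sup>2 * (indicator (cball 0 R) x * (\<Sum>b\<in>Basis. (g b x)\<^sup>2)))"
  proof -
    have "integrable lborel (\<lambda>x. indicator (cball 0 R) x *\<^sub>R (2 * (w x)\<^sup>2 * (\<Sum>b\<in>Basis. (g b x)\<^sup>2)))"
      by (intro borel_integrable_compact continuous_intros continuous_on_subset[OF w]
            continuous_on_subset[OF g(1)]) auto
    thus ?thesis by (simp add: mult_ac)
  qed
  have "(1 / 2) * (\<integral>x. (\<eta> x)\<^sup>2 * (\<Sum>b\<in>Basis. (p b x)\<^sup>2) \<partial>lborel)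
        - (\<integral>x. 2 * (w x)\<^sup>2 * (indicator (cball 0 R) x * (\<Sum>b\<in>Basis. (g b x)\<^sup>2)) \<partial>lborel)
        + (\<integral>x. (\<eta> x)\<^sup>2 * w x * F x \<partial>lborel)
    = (\<integral>x. (1 / 2) * ((\<eta> x)\<^sup>2 * (\<Sum>b\<in>Basis. (p b x)\<^sup>2))
        - 2 * (w x)\<^sup>2 * (indicator (cball 0 R) x * (\<Sum>b\<in>Basis. (g b x)\<^sup>2)) + (\<eta> x)\<^sup>2 * w x * F x \<partial>lborel)"
    using i1 i2 i3 by simp
  also have "\<dots> \<le> (\<integral>x. (\<Sum>b\<in>Basis. ?T b x) \<partial>lborel)"
  proof (rule integral_mono)
    fix x :: 'a
    let ?I = "indicator (cball 0 R) x :: real"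
    have "(1 / 2) * ((\<eta> x)\<^sup>2 * (\<Sum>b\<in>Basis. (p b x)\<^sup>2))
        - 2 * (w x)\<^sup>2 * (?I * (\<Sum>b\<in>Basis. (g b x)\<^sup>2)) + (\<eta> x)\<^sup>2 * w x * F x
      = (\<Sum>b\<in>Basis. (1 / 2) * ((\<eta> x)\<^sup>2 * (p b x)\<^sup>2) - 2 * (w x)\<^sup>2 * (?I * (g b x)\<^sup>2) + (\<eta> x)\<^sup>2 * w x * q b x)"
      by (simp only: F sum.distrib sum_subtractf sum_distrib_left mult.assoc)
    also have "\<dots> \<le> (\<Sum>b\<in>Basis. ?T b x)"
    proof (rule sum_mono)
      fix b :: 'a
      show "(1 / 2) * ((\<eta> x)\<^sup>2 * (p b x)\<^sup>2) - 2 * (w x)\<^sup>2 * (?I * (g b x)\<^sup>2) + (\<eta> x)\<^sup>2 * w x * q b x \<le> ?T b x"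
      proof (cases "norm x \<le> R")
        case True
        \<comment> \<open>The difference of the two sides is this square.\<close>
        have "0 \<le> (1 / 2) * (\<eta> x * p b x + 2 * w x * g b x)\<^sup>2" by simp
        thus ?thesis using True by (simp add: power2_eq_square algebra_simps)
      qed (use eta0 in auto)
    qed
    finally show "(1 / 2) * ((\<eta> x)\<^sup>2 * (\<Sum>b\<in>Basis. (p b x)\<^sup>2))
        - 2 * (w x)\<^sup>2 * (?I * (\<Sum>b\<in>Basis. (g b x)\<^sup>2)) + (\<eta> x)\<^sup>2 * w x * F x \<le> (\<Sum>b\<in>Basis. ?T b x)" .
  qed (use i1 i2 i3 intT in auto)
  also have "\<dots> = 0" using intT T0 by simp
  finally show ?thesis by linarith
qed

text \<open>Testing the equation with the reflected translates of \<open>\<phi>\<close>.\<close>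

lemma conv_laplacian:
  assumes weak: "\<And>\<phi>. test_function \<phi> \<Longrightarrow>
      (\<integral>y. laplacian \<phi> y * u y \<partial>lborel) = (\<integral>y. \<phi> y * (V y * u y) \<partial>lborel)"
    and \<phi>: "test_function \<phi>" and u: "loc_int u"
  shows "(\<Sum>b\<in>Basis. conv (partial_deriv b (partial_deriv b \<phi>)) u x) = conv \<phi> (\<lambda>y. V y * u y) x"
proof -
  obtain R where R: "supp_in R \<phi>" using test_function_supp_in[OF \<phi>] .
  have "integrable lborel (\<lambda>y. partial_deriv b (partial_deriv b \<phi>) (x - y) * u y)"
    if "b \<in> Basis" for b
    using that by (intro conv_integrable[OF u _ supp_in_partial_deriv[OF supp_in_partial_deriv[OF R]]]
          test_function_continuous test_function_partial_deriv \<phi>)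
  hence "(\<Sum>b\<in>Basis. conv (partial_deriv b (partial_deriv b \<phi>)) u x)
      = (\<integral>y. (\<Sum>b\<in>Basis. partial_deriv b (partial_deriv b \<phi>) (x - y) * u y) \<partial>lborel)"
    unfolding conv_def by (intro Bochner_Integration.integral_sum[symmetric])
  also have "\<dots> = (\<integral>y. laplacian (\<lambda>y. \<phi> (x - y)) y * u y \<partial>lborel)"
    unfolding laplacian_reflect[OF \<phi>] by (simp add: laplacian_def sum_distrib_right)
  also have "\<dots> = conv \<phi> (\<lambda>y. V y * u y) x"
    unfolding conv_def by (rule weak[OF test_function_reflect[OF \<phi>]])
  finally show ?thesis .
qed

text \<open>The energy estimate for \<open>w = \<rho> * u\<close>, where \<open>\<Delta>w = \<rho> * (V u)\<close>. Replacing
  \<open>\<rho> * (V u)\<close> by \<open>V w\<close> costs at most the oscillation \<open>\<delta>\<close> of \<open>V\<close> on the scale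
  \<open>\<epsilon>\<close> times \<open>\<rho> * \<bar>u\<bar>\<close>, and \<open>V w\<^sup>2\<close> has a good sign. Jensen's
  inequality bounds both \<open>w\<^sup>2\<close> and \<open>(\<rho> * \<bar>u\<bar>)\<^sup>2\<close> by \<open>A + \<rho> * h\<close>, and
  \<open>\<integral>\<rho> * h = \<integral>h\<close> makes the resulting bound independent of \<open>\<rho>\<close>.\<close>

lemma mollified_energy_bound:
  fixes u V h \<eta> :: "'a::euclidean_space \<Rightarrow> real" and g :: "'a \<Rightarrow> 'a \<Rightarrow> real"
  assumes weak: "\<And>\<phi>. test_function \<phi> \<Longrightarrow>
      (\<integral>y. laplacian \<phi> y * u y \<partial>lborel) = (\<integral>y. \<phi> y * (V y * u y) \<partial>lborel)"
    and u: "loc_int u" "\<And>x. (u x)\<^sup>2 \<le> A + h x"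
    and h: "integrable lborel h" "\<And>x. 0 \<le> h x" and A: "0 \<le> A"
    and V: "continuous_on UNIV V" "\<And>x. 0 \<le> V x"
    and \<rho>: "mollifier \<epsilon> \<rho>"
    and osc: "\<And>x y. norm x \<le> R \<Longrightarrow> norm (x - y) \<le> \<epsilon> \<Longrightarrow> \<bar>V y - V x\<bar> \<le> \<delta>"
    and \<eta>: "continuous_on UNIV \<eta>" "supp_in R \<eta>" "\<And>x. 0 \<le> \<eta> x" "\<And>x. \<eta> x \<le> 1"
    and g: "\<And>b. b \<in> Basis \<Longrightarrow> continuous_on UNIV (g b)"
      "\<And>b. b \<in> Basis \<Longrightarrow> deriv_along b (\<lambda>x. (\<eta> x)\<^sup>2) (\<lambda>x. 2 * \<eta> x * g b x)"
    and \<theta>: "\<And>x. (\<Sum>b\<in>Basis. (g b x)\<^sup>2) \<le> \<theta>"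
      "(\<integral>x. indicator (cball 0 R) x * (\<Sum>b\<in>Basis. (g b x)\<^sup>2) \<partial>lborel) \<le> \<theta>"
    and \<delta>: "0 \<le> \<delta>"
  shows "(1 / 2) * (\<integral>x. (\<eta> x)\<^sup>2 * (\<Sum>b\<in>Basis. (conv (partial_deriv b \<rho>) u x)\<^sup>2) \<partial>lborel)
    \<le> 2 * \<theta> * (A + (\<integral>x. h x \<partial>lborel))
      + \<delta> * (A * measure lborel (cball 0 R :: 'a set) + (\<integral>x. h x \<partial>lborel))"
proof -
  note \<rho>D = mollifierD[OF \<rho>]
  let ?w = "conv \<rho> u" and ?F = "conv \<rho> (\<lambda>y. V y * u y)" and ?a = "conv \<rho> (\<lambda>y. \<bar>u y\<bar>)"
  let ?H = "\<integral>x. h x \<partial>lborel" and ?h = "conv \<rho> h"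
  let ?I = "indicator (cball 0 R) :: 'a \<Rightarrow> real" and ?G = "\<lambda>x. \<Sum>b\<in>Basis. (g b x)\<^sup>2"
  have um [measurable]: "u \<in> borel_measurable borel" using u(1) by (simp add: loc_int_def)
  have lh: "loc_int h" using h(1) by (rule loc_int_integrable)
  have lc: "loc_int (\<lambda>_::'a. c)" for c by (intro loc_int_continuous continuous_intros)
  have lu2: "loc_int (\<lambda>y. (u y)\<^sup>2)"
    by (rule loc_int_bound[OF loc_int_add[OF lc[of A] lh]]) (use u(2) in auto)
  have la: "loc_int (\<lambda>y. \<bar>u y\<bar>)" using u(1) by (rule loc_int_abs)
  have lV: "loc_int (\<lambda>y. V y * u y)" by (rule loc_int_continuous_mult[OF u(1) V(1)])
  note h' = integral_conv[OF \<rho> h]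
  have cw: "continuous_on UNIV ?w" "continuous_on UNIV ?F"
    by (intro conv_continuous[OF _ \<rho>D(4,2)] u lV)+
  have a2: "(?a x)\<^sup>2 \<le> A + ?h x" for x
  proof -
    have "(?a x)\<^sup>2 \<le> conv \<rho> (\<lambda>y. \<bar>u y\<bar>\<^sup>2) x"
      using lu2 by (intro conv_square_le[OF \<rho> la]) simp
    also have "\<dots> \<le> conv \<rho> (\<lambda>y. A + h y) x"
      using u(2) lu2 by (intro conv_mono[OF \<rho>] loc_int_add lc lh) auto
    also have "\<dots> = A + ?h x"
      using conv_add[OF lc lh \<rho>D(4,2)] conv_const[OF \<rho>] by simp
    finally show ?thesis .
  qed
  have wa: "\<bar>?w x\<bar> \<le> ?a x" for x
  proof -
    have "?w x \<le> ?a x" by (intro conv_mono[OF \<rho>] u la) auto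
    moreover have "conv \<rho> (\<lambda>y. - 1 * u y) x \<le> ?a x"
      by (intro conv_mono[OF \<rho>] la loc_int_continuous_mult[OF u(1)] continuous_intros) auto
    ultimately show ?thesis unfolding conv_cmult by linarith
  qed
  have w2: "(?w x)\<^sup>2 \<le> A + ?h x" for x
    using power_mono[OF wa[of x], of 2] a2[of x] by simp
  have F: "- ((\<eta> x)\<^sup>2 * ?w x * ?F x) \<le> \<delta> * (A * ?I x + ?h x)" for x
  proof (cases "norm x \<le> R")
    case True
    have lVx: "loc_int (\<lambda>y. V x * u y)" by (intro loc_int_continuous_mult[OF u(1)] continuous_intros)
    have l\<delta>: "loc_int (\<lambda>y. \<delta> * \<bar>u y\<bar>)" by (intro loc_int_continuous_mult[OF la] continuous_intros)
    have e: "\<bar>V y * u y - V x * u y\<bar> \<le> \<delta> * \<bar>u y\<bar>" if "norm (x - y) \<le> \<epsilon>" for y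
      using mult_right_mono[OF osc[OF True that], of "\<bar>u y\<bar>"]
      by (simp only: left_diff_distrib[symmetric] abs_mult)
    have "?F x \<le> conv \<rho> (\<lambda>y. V x * u y + \<delta> * \<bar>u y\<bar>) x"
      using e by (intro conv_mono[OF \<rho>] loc_int_add lV lVx l\<delta>) (fastforce simp: abs_le_iff)
    moreover have "conv \<rho> (\<lambda>y. V x * u y) x \<le> conv \<rho> (\<lambda>y. V y * u y + \<delta> * \<bar>u y\<bar>) x"
      using e by (intro conv_mono[OF \<rho>] loc_int_add lV lVx l\<delta>) (fastforce simp: abs_le_iff)
    ultimately have "\<bar>?F x - V x * ?w x\<bar> \<le> \<delta> * ?a x"
      by (simp add: conv_add[OF lVx l\<delta> \<rho>D(4,2)] conv_add[OF lV l\<delta> \<rho>D(4,2)] conv_cmult abs_le_iff)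
    hence "\<bar>?w x\<bar> * \<bar>?F x - V x * ?w x\<bar> \<le> ?a x * (\<delta> * ?a x)"
      using wa[of x] by (intro mult_mono) auto
    hence 1: "- (?w x * (?F x - V x * ?w x)) \<le> \<delta> * (?a x)\<^sup>2"
      by (simp only: abs_mult[symmetric] power2_eq_square) (simp add: abs_le_iff mult_ac)
    have 2: "0 \<le> V x * (?w x)\<^sup>2" using V(2) by simp
    have 3: "- (?w x * ?F x) \<le> \<delta> * (A + ?h x)"
      using 1 2 mult_left_mono[OF a2[of x] \<delta>] by (simp add: power2_eq_square algebra_simps)
    have 4: "0 \<le> \<delta> * (A + ?h x)" using \<delta> A h'(3)[of x] by simp
    have "(\<eta> x)\<^sup>2 * - (?w x * ?F x) \<le> (\<eta> x)\<^sup>2 * (\<delta> * (A + ?h x))"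
      by (intro mult_left_mono 3) auto
    also have "\<dots> \<le> 1 * (\<delta> * (A + ?h x))"
      using \<eta>(3,4) by (intro mult_right_mono 4) (simp add: power_le_one)
    finally show ?thesis using True by (simp add: mult.assoc)
  next
    case False
    hence "\<eta> x = 0" using \<eta>(2) by (simp add: supp_in_def)
    thus ?thesis using \<delta> A h'(3)[of x] by simp
  qed
  have iI: "integrable lborel ?I" by (intro integrable_real_indicator emeasure_lborel_cball_finite) auto
  have G0: "0 \<le> ?G x" for x by (intro sum_nonneg) auto
  have iG: "integrable lborel (\<lambda>x. ?I x * ?G x)"
  proof -
    have "integrable lborel (\<lambda>x. ?I x *\<^sub>R ?G x)"
      by (intro borel_integrable_compact continuous_intros continuous_on_subset[OF g(1)]) auto
    thus ?thesis by simp
  qed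
  have "(\<integral>x. 2 * (?w x)\<^sup>2 * (?I x * ?G x) \<partial>lborel)
      \<le> (\<integral>x. 2 * A * (?I x * ?G x) + 2 * \<theta> * ?h x \<partial>lborel)"
  proof (rule integral_mono_AE'[OF _ AE_I2 AE_I2])
    have th: "0 \<le> \<theta>" using G0 \<theta>(1) order.trans by blast
    show "integrable lborel (\<lambda>x. 2 * A * (?I x * ?G x) + 2 * \<theta> * ?h x)" using iG h'(1) by simp
    fix x
    have b: "?I x * ?G x \<le> \<theta>" using \<theta>(1)[of x] th by (auto simp: indicator_def)
    have b0: "0 \<le> ?I x * ?G x" using G0[of x] by simp
    have "(?w x)\<^sup>2 * (?I x * ?G x) \<le> (A + ?h x) * (?I x * ?G x)"
      by (intro mult_right_mono w2 b0)
    also have "\<dots> \<le> A * (?I x * ?G x) + \<theta> * ?h x"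
      using mult_right_mono[OF b h'(3)[of x]] by (simp add: algebra_simps)
    finally show "2 * (?w x)\<^sup>2 * (?I x * ?G x) \<le> 2 * A * (?I x * ?G x) + 2 * \<theta> * ?h x" by simp
    show "0 \<le> 2 * A * (?I x * ?G x) + 2 * \<theta> * ?h x"
      using A b0 th h'(3)[of x] by simp
  qed
  also have "\<dots> = 2 * A * (\<integral>x. ?I x * ?G x \<partial>lborel) + 2 * \<theta> * ?H"
    using iG h'(1,2) by simp
  also have "\<dots> \<le> 2 * \<theta> * (A + ?H)"
    using mult_left_mono[OF \<theta>(2), of "2 * A"] A by (simp add: algebra_simps)
  finally have W: "(\<integral>x. 2 * (?w x)\<^sup>2 * (?I x * ?G x) \<partial>lborel) \<le> 2 * \<theta> * (A + ?H)" .
  have "- (\<integral>x. (\<eta> x)\<^sup>2 * ?w x * ?F x \<partial>lborel) = (\<integral>x. - ((\<eta> x)\<^sup>2 * ?w x * ?F x) \<partial>lborel)" by simp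
  also have "\<dots> \<le> (\<integral>x. \<delta> * (A * ?I x + ?h x) \<partial>lborel)"
    using iI h'(1,3) \<delta> A F by (intro integral_mono_AE'[OF _ AE_I2 AE_I2]) auto
  also have "\<dots> = \<delta> * (A * measure lborel (cball 0 R :: 'a set) + ?H)"
    using iI h'(1,2) by simp
  finally have E: "- (\<integral>x. (\<eta> x)\<^sup>2 * ?w x * ?F x \<partial>lborel)
      \<le> \<delta> * (A * measure lborel (cball 0 R :: 'a set) + ?H)" .
  note tp = test_function_partial_deriv[OF \<rho>D(1)]
  have "(1 / 2) * (\<integral>x. (\<eta> x)\<^sup>2 * (\<Sum>b\<in>Basis. (conv (partial_deriv b \<rho>) u x)\<^sup>2) \<partial>lborel)
     \<le> (\<integral>x. 2 * (?w x)\<^sup>2 * (?I x * ?G x) \<partial>lborel) - (\<integral>x. (\<eta> x)\<^sup>2 * ?w x * ?F x \<partial>lborel)"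
  proof (rule energy_estimate[OF \<eta>(1,2) g cw(1), where q = "\<lambda>b. conv (partial_deriv b (partial_deriv b \<rho>)) u"])
    fix b :: 'a assume b: "b \<in> Basis"
    note c = test_function_continuous[OF \<rho>D(1)] \<rho>D(2)
      test_function_continuous[OF tp[OF b]] supp_in_partial_deriv[OF \<rho>D(2), of b]
      test_function_continuous[OF test_function_partial_deriv[OF tp[OF b] b]]
      supp_in_partial_deriv[OF supp_in_partial_deriv[OF \<rho>D(2), of b], of b]
    show "continuous_on UNIV (conv (partial_deriv b \<rho>) u)"
      "continuous_on UNIV (conv (partial_deriv b (partial_deriv b \<rho>)) u)"
      using conv_continuous[OF u(1)] c by blast+
    show "deriv_along b ?w (conv (partial_deriv b \<rho>) u)"
      by (rule conv_deriv_along[OF u(1) c(1,2,3,4) test_function_deriv_along[OF \<rho>D(1)]])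
    show "deriv_along b (conv (partial_deriv b \<rho>) u) (conv (partial_deriv b (partial_deriv b \<rho>)) u)"
      by (rule conv_deriv_along[OF u(1) c(3,4,5,6) test_function_deriv_along[OF tp[OF b]]])
  next
    show "?F x = (\<Sum>b\<in>Basis. conv (partial_deriv b (partial_deriv b \<rho>)) u x)" for x
      by (rule conv_laplacian[OF weak \<rho>D(1) u(1), symmetric])
  qed
  thus ?thesis using W E by linarith
qed

section \<open>Logarithmic cutoffs in the plane\<close>

lemma DERIV_pos_part_square:
  "((\<lambda>s::real. (max 0 s)\<^sup>2) has_real_derivative 2 * max 0 s) (at s)"
proof -
  consider "0 < s" | "s < 0" | "s = 0" by linarith
  thus ?thesis
  proof cases
    case 1
    have "((\<lambda>s::real. s\<^sup>2) has_real_derivative 2 * max 0 s) (at s)"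
      using 1 by (auto intro!: derivative_eq_intros)
    thus ?thesis
      by (rule has_field_derivative_transform_within_open[of _ _ _ "{0<..}"]) (use 1 in auto)
  next
    case 2
    have "((\<lambda>s::real. 0) has_real_derivative 2 * max 0 s) (at s)" using 2 by simp
    thus ?thesis
      by (rule has_field_derivative_transform_within_open[of _ _ _ "{..<0}"]) (use 2 in auto)
  next
    case 3
    have "((\<lambda>y::real. (max 0 y)\<^sup>2 / y) \<longlongrightarrow> 0) (at 0)"
    proof (rule Lim_null_comparison)
      show "\<forall>\<^sub>F y in at 0. norm ((max 0 y)\<^sup>2 / y) \<le> \<bar>y::real\<bar>"
        by (intro always_eventually allI) (auto simp: max_def power2_eq_square)
    qed (rule tendsto_eq_intros refl | simp)+
    thus ?thesis using 3 by (simp add: has_field_derivative_iff)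
  qed
qed

text \<open>The plane has zero capacity at infinity: the gradient of this cutoff has size
  \<open>2 / (N \<bar>x\<bar>)\<close>, and the square integral of that over the support is of order \<open>1 / N\<close>.\<close>

definition log_cutoff :: "nat \<Rightarrow> 'a::real_inner \<Rightarrow> real" where
  "log_cutoff N x = max 0 (1 - ln (1 + x \<bullet> x) / N)"

lemma inner_plus_one_pos: "0 < 1 + x \<bullet> (x :: 'a::real_inner)"
  using inner_ge_zero[of x] by linarith

lemma log_cutoff_deriv:
  "deriv_along v (\<lambda>x. (log_cutoff N x)\<^sup>2)
     (\<lambda>x. 2 * log_cutoff N x * (- 2 * (x \<bullet> v) / (N * (1 + x \<bullet> x))))"
  unfolding deriv_along_def
proof
  fix x :: 'a
  have d1: "((\<lambda>t. 1 + (x + t *\<^sub>R v) \<bullet> (x + t *\<^sub>R v)) has_real_derivative 2 * (x \<bullet> v)) (at 0)"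
  proof -
    have "(\<lambda>t. 1 + (x + t *\<^sub>R v) \<bullet> (x + t *\<^sub>R v)) = (\<lambda>t. 1 + x \<bullet> x + 2 * t * (x \<bullet> v) + t\<^sup>2 * (v \<bullet> v))"
      by (auto simp: algebra_simps power2_eq_square inner_commute)
    thus ?thesis by (auto intro!: derivative_eq_intros)
  qed
  have d2: "((\<lambda>t. ln (1 + (x + t *\<^sub>R v) \<bullet> (x + t *\<^sub>R v))) has_real_derivative
      2 * (x \<bullet> v) / (1 + x \<bullet> x)) (at 0)"
    using inner_plus_one_pos[of x]
    by (intro DERIV_chain2[OF DERIV_ln d1, THEN DERIV_cong]) (auto simp: inverse_eq_divide)
  have "((\<lambda>t. 1 - ln (1 + (x + t *\<^sub>R v) \<bullet> (x + t *\<^sub>R v)) / N) has_real_derivative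
      - 2 * (x \<bullet> v) / (N * (1 + x \<bullet> x))) (at 0)"
    by (rule DERIV_diff[OF DERIV_const DERIV_cdivide[OF d2], THEN DERIV_cong]) simp
  from DERIV_chain2[OF DERIV_pos_part_square this]
  show "((\<lambda>t. (log_cutoff N (x + t *\<^sub>R v))\<^sup>2) has_real_derivative
     2 * log_cutoff N x * (- 2 * (x \<bullet> v) / (N * (1 + x \<bullet> x)))) (at 0)"
    by (simp add: log_cutoff_def)
qed

text \<open>The support is exhausted by the balls of radius \<open>exp (k / 2)\<close>. Where \<open>1 + \<bar>x\<bar>\<^sup>2\<close> lies
  between \<open>exp (k - 1)\<close> and \<open>exp k\<close>, the integrand is at most \<open>exp (1 - k)\<close>, so that each
  of the \<open>N + 1\<close> balls contributes the same constant.\<close>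

lemma integral_inverse_square_le:
  fixes N :: nat
  defines "R \<equiv> exp (real N / 2)"
  shows "(\<integral>x. indicator (cball 0 R) x * (1 / (1 + x \<bullet> x)) \<partial>(lborel :: (real ^ 2) measure))
     \<le> (N + 1) * (exp 1 * pi)"
proof -
  let ?S = "\<lambda>x::real^2. \<Sum>k\<in>{1..N + 1}. exp (1 - real k) * indicator (cball 0 (exp (real k / 2))) x"
  have vol: "measure lborel (cball 0 (exp (real k / 2)) :: (real^2) set) = pi * exp (real k)" for k
    by (simp add: content_cball unit_ball_vol_2 exp_of_nat_mult[symmetric] exp_double[symmetric])
  have ptw: "indicator (cball 0 R) x * (1 / (1 + x \<bullet> x)) \<le> ?S x" for x :: "real^2"
  proof (cases "norm x \<le> R")
    case True
    define L where "L = ln (1 + x \<bullet> x)"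
    define k where "k = max 1 (nat \<lceil>L\<rceil>)"
    have eL: "exp L = 1 + x \<bullet> x" using inner_plus_one_pos[of x] by (simp add: L_def)
    have L0: "0 \<le> L" using inner_ge_zero[of x] by (simp add: L_def)
    have "x \<bullet> x = (norm x)\<^sup>2" by (simp add: power2_norm_eq_inner)
    also have "\<dots> \<le> R\<^sup>2" using True by (intro power_mono) auto
    also have "\<dots> = exp N" by (simp add: R_def exp_double[symmetric])
    finally have "1 + x \<bullet> x \<le> 2 * exp N" using one_le_exp_iff[of "real N"] by linarith
    also have "\<dots> \<le> exp 1 * exp N" using exp_ge_add_one_self[of 1] by (intro mult_right_mono) auto
    finally have "exp L \<le> exp (real N + 1)" unfolding eL by (simp add: exp_add mult.commute)
    hence LN: "L \<le> real N + 1" by simp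
    hence "k \<le> N + 1" by (simp add: k_def ceiling_le_iff nat_le_iff)
    hence k: "k \<in> {1..N + 1}" by (simp add: k_def)
    have kL: "L \<le> k" "real k - 1 \<le> L" using L0 unfolding k_def by linarith+
    have "(norm x)\<^sup>2 \<le> exp L" unfolding eL by (simp add: power2_norm_eq_inner)
    also have "\<dots> \<le> (exp (real k / 2))\<^sup>2" using kL by (simp add: exp_double[symmetric])
    finally have nx: "norm x \<le> exp (real k / 2)" by (rule power2_le_imp_le) simp
    have "1 / (1 + x \<bullet> x) = exp (- L)" unfolding eL[symmetric] by (simp add: exp_minus inverse_eq_divide)
    also have "\<dots> \<le> exp (1 - real k) * indicator (cball 0 (exp (real k / 2))) x"
      using kL nx by simp
    also have "\<dots> \<le> ?S x" by (rule member_le_sum[OF k]) auto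
    finally show ?thesis using True by simp
  qed (simp add: sum_nonneg del: sum.cl_ivl_Suc)
  have i: "integrable lborel (\<lambda>x::real^2. indicator (cball 0 r) x :: real)" for r
    by (intro integrable_real_indicator emeasure_lborel_cball_finite) auto
  have "(\<integral>x. indicator (cball 0 R) x * (1 / (1 + x \<bullet> x)) \<partial>(lborel :: (real ^ 2) measure))
     \<le> (\<integral>x. ?S x \<partial>lborel)"
    using i ptw by (intro integral_mono_AE'[OF _ AE_I2 AE_I2] Bochner_Integration.integrable_sum
        integrable_mult_right sum_nonneg) auto
  also have "\<dots> = (\<Sum>k\<in>{1..N + 1}. exp (1 - real k) * (pi * exp (real k)))"
    using i vol by (subst Bochner_Integration.integral_sum) auto
  also have "\<dots> = (\<Sum>k\<in>{1..N + 1}. exp 1 * pi)"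
    by (intro sum.cong refl) (simp add: exp_diff)
  finally show ?thesis by simp
qed

text \<open>The uniform bound by \<open>\<theta>\<close> serves against the integrable part of \<open>u\<^sup>2\<close>, the integral bound
  against the constant part.\<close>

lemma planar_cutoff_exists:
  fixes r :: real
  assumes "0 < \<theta>"
  obtains \<eta> :: "real ^ 2 \<Rightarrow> real" and R :: real and g :: "real ^ 2 \<Rightarrow> real ^ 2 \<Rightarrow> real"
  where "continuous_on UNIV \<eta>" "supp_in R \<eta>" "\<And>x. 0 \<le> \<eta> x" "\<And>x. \<eta> x \<le> 1"
    "\<And>x. norm x \<le> r \<Longrightarrow> 1 / 2 \<le> \<eta> x"
    "\<And>b. continuous_on UNIV (g b)"
    "\<And>b. deriv_along b (\<lambda>x. (\<eta> x)\<^sup>2) (\<lambda>x. 2 * \<eta> x * g b x)"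
    "\<And>x. (\<Sum>b\<in>Basis. (g b x)\<^sup>2) \<le> \<theta>"
    "(\<integral>x. indicator (cball 0 R) x * (\<Sum>b\<in>Basis. (g b x)\<^sup>2) \<partial>lborel) \<le> \<theta>"
proof -
  define C where "C = 8 * exp 1 * pi + 4"
  have C: "4 \<le> C" "8 * exp 1 * pi \<le> C" by (auto simp: C_def)
  obtain N :: nat where N: "max (C / \<theta>) (2 * ln (1 + r\<^sup>2)) < N" using reals_Archimedean2 by blast
  have "0 < C / \<theta>" using C assms by simp
  hence N0: "0 < real N" using N by linarith
  hence N1: "1 \<le> real N" by simp
  have CN: "C / N \<le> \<theta>" using N N0 assms by (simp add: field_simps)
  define R where "R = exp (real N / 2)"
  define \<eta> :: "real^2 \<Rightarrow> real" where "\<eta> = log_cutoff N"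
  define g :: "real^2 \<Rightarrow> real^2 \<Rightarrow> real" where "g = (\<lambda>b x. - 2 * (x \<bullet> b) / (N * (1 + x \<bullet> x)))"
  have pos: "0 < 1 + x \<bullet> x" for x :: "real^2" by (rule inner_plus_one_pos)
  have nz: "1 + x \<bullet> x \<noteq> 0" for x :: "real^2" using pos[of x] by linarith
  have G: "(\<Sum>b\<in>Basis. (g b x)\<^sup>2) = 4 * (x \<bullet> x) / (N * (1 + x \<bullet> x))\<^sup>2" for x
  proof -
    have "(\<Sum>b\<in>Basis. (g b x)\<^sup>2) = 4 / (N * (1 + x \<bullet> x))\<^sup>2 * (\<Sum>b\<in>Basis. (x \<bullet> b) * (x \<bullet> b))"
      unfolding g_def sum_distrib_left by (intro sum.cong refl) (simp add: power_divide power2_eq_square)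
    thus ?thesis by (simp add: euclidean_inner[symmetric])
  qed
  have scale: "4 * s / (N * s)\<^sup>2 = 4 / N\<^sup>2 * (1 / s)" if "s \<noteq> 0" for s :: real
    using that by (simp add: power_mult_distrib power2_eq_square)
  have G2: "(\<Sum>b\<in>Basis. (g b x)\<^sup>2) \<le> 4 / N\<^sup>2 * (1 / (1 + x \<bullet> x))" for x
  proof -
    have "4 * (x \<bullet> x) / (N * (1 + x \<bullet> x))\<^sup>2 \<le> 4 * (1 + x \<bullet> x) / (N * (1 + x \<bullet> x))\<^sup>2"
      by (intro divide_right_mono) auto
    also have "\<dots> = 4 / N\<^sup>2 * (1 / (1 + x \<bullet> x))"
      using scale[OF nz[of x]] .
    finally show ?thesis unfolding G .
  qed
  have NC: "4 / N\<^sup>2 * y \<le> \<theta>" if "y \<le> (C / 4) * N" for y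
  proof -
    have "4 / N\<^sup>2 * y \<le> 4 / N\<^sup>2 * ((C / 4) * N)" by (intro mult_left_mono that) auto
    also have "\<dots> = C / N" using N0 by (simp add: power2_eq_square)
    finally show ?thesis using CN by linarith
  qed
  have 1: "supp_in R \<eta>"
    unfolding supp_in_def
  proof (intro allI impI)
    fix x :: "real^2" assume that: "R < norm x"
    have "R\<^sup>2 < (norm x)\<^sup>2" using that by (intro power_strict_mono) (auto simp: R_def)
    hence "exp (real N) < 1 + x \<bullet> x"
      by (simp add: R_def exp_double[symmetric] power2_norm_eq_inner)
    hence "ln (exp (real N)) < ln (1 + x \<bullet> x)" using pos[of x] by (subst ln_less_cancel_iff) auto
    hence "real N < ln (1 + x \<bullet> x)" by simp
    thus "\<eta> x = 0" using N0 by (simp add: \<eta>_def log_cutoff_def field_simps)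
  qed
  have 2: "0 \<le> \<eta> x \<and> \<eta> x \<le> 1" for x
    using N0 by (simp add: \<eta>_def log_cutoff_def)
  have 3: "1 / 2 \<le> \<eta> x" if "norm x \<le> r" for x
  proof -
    have "x \<bullet> x \<le> r\<^sup>2" using that by (simp add: power2_norm_eq_inner[symmetric] power_mono)
    hence "ln (1 + x \<bullet> x) \<le> ln (1 + r\<^sup>2)" using pos[of x] by simp
    hence "2 * ln (1 + x \<bullet> x) \<le> N" using N by linarith
    thus ?thesis using N0 by (simp add: \<eta>_def log_cutoff_def field_simps)
  qed
  have 4: "continuous_on UNIV \<eta>"
    unfolding \<eta>_def log_cutoff_def[abs_def] using nz N0 by (intro continuous_intros) auto
  have 5: "continuous_on UNIV (g b)" for b
    unfolding g_def using N0 nz by (intro continuous_intros) auto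
  have 6: "deriv_along b (\<lambda>x. (\<eta> x)\<^sup>2) (\<lambda>x. 2 * \<eta> x * g b x)" for b
    unfolding \<eta>_def g_def by (rule log_cutoff_deriv)
  have 7: "(\<Sum>b\<in>Basis. (g b x)\<^sup>2) \<le> \<theta>" for x
  proof (rule order.trans[OF G2 NC])
    have "1 / (1 + x \<bullet> x) \<le> 1" using pos[of x] by (subst divide_le_eq_1_pos) auto
    moreover have "1 * 1 \<le> (C / 4) * N" using C N1 by (intro mult_mono) auto
    ultimately show "1 / (1 + x \<bullet> x) \<le> (C / 4) * N" by linarith
  qed
  have 8: "(\<integral>x. indicator (cball 0 R) x * (\<Sum>b\<in>Basis. (g b x)\<^sup>2) \<partial>lborel) \<le> \<theta>"
  proof -
    let ?f = "\<lambda>x::real^2. indicator (cball 0 R) x * (1 / (1 + x \<bullet> x)) :: real"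
    have i: "integrable lborel ?f"
    proof -
      have "integrable lborel (\<lambda>x::real^2. indicator (cball 0 R) x *\<^sub>R (1 / (1 + x \<bullet> x)))"
        using nz by (intro borel_integrable_compact continuous_intros) auto
      thus ?thesis by simp
    qed
    have "(\<integral>x. indicator (cball 0 R) x * (\<Sum>b\<in>Basis. (g b x)\<^sup>2) \<partial>lborel) \<le> (\<integral>x. 4 / N\<^sup>2 * ?f x \<partial>lborel)"
    proof (rule integral_mono_AE'[OF _ AE_I2 AE_I2])
      show "integrable lborel (\<lambda>x. 4 / N\<^sup>2 * ?f x)" using i by (rule integrable_mult_right)
      fix x :: "real^2"
      show "indicator (cball 0 R) x * (\<Sum>b\<in>Basis. (g b x)\<^sup>2) \<le> 4 / N\<^sup>2 * ?f x"
        using G2[of x] by (auto simp: indicator_def)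
      show "0 \<le> 4 / N\<^sup>2 * ?f x" using pos[of x] by simp
    qed
    also have "\<dots> = 4 / N\<^sup>2 * (\<integral>x. ?f x \<partial>lborel)" by (rule integral_mult_right_zero)
    also have "\<dots> \<le> \<theta>"
    proof (rule NC)
      have "(\<integral>x. ?f x \<partial>lborel) \<le> (N + 1) * (exp 1 * pi)"
        using integral_inverse_square_le[of N] by (simp add: R_def)
      also have "\<dots> \<le> (2 * N) * (exp 1 * pi)" using N1 by (intro mult_right_mono) auto
      also have "\<dots> = (8 * exp 1 * pi) / 4 * N" by simp
      also have "\<dots> \<le> (C / 4) * N" using C by (intro mult_right_mono divide_right_mono) auto
      finally show "(\<integral>x. ?f x \<partial>lborel) \<le> (C / 4) * N" .
    qed
    finally show ?thesis .
  qed
  show ?thesis using 1 2 3 4 5 6 7 8 by (intro that[of \<eta> R g]) auto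
qed

section \<open>Vanishing of the weak gradient\<close>

text \<open>The gradients \<open>p\<close> of the mollifications of \<open>u\<close> tend to zero in \<open>L\<^sup>2\<close> on bounded sets by the energy
  bound, and they converge weakly to the gradient of \<open>u\<close>. The parameters are chosen in the order
  \<open>s\<close> (the weight in Young's inequality), the cutoff, the admissible oscillation \<open>\<delta>\<close> of \<open>V\<close>, the mollification scale.\<close>

lemma test_gradient_vanishes:
  fixes u V h :: "real ^ 2 \<Rightarrow> real"
  assumes weak: "\<And>\<phi>. test_function \<phi> \<Longrightarrow>
      (\<integral>y. laplacian \<phi> y * u y \<partial>lborel) = (\<integral>y. \<phi> y * (V y * u y) \<partial>lborel)"
    and u: "loc_int u" "\<And>x. (u x)\<^sup>2 \<le> A + h x"
    and h: "integrable lborel h" "\<And>x. 0 \<le> h x" and A: "0 \<le> A"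
    and V: "continuous_on UNIV V" "\<And>x. 0 \<le> V x"
    and \<phi>: "test_function \<phi>" and b: "b \<in> Basis"
  shows "(\<integral>x. u x * partial_deriv b \<phi> x \<partial>lborel) = 0"
proof -
  let ?\<psi> = "partial_deriv b \<phi>" and ?H = "\<integral>x. h x \<partial>lborel"
  define \<Phi> where "\<Phi> = (\<integral>x. (\<phi> x)\<^sup>2 \<partial>lborel)"
  obtain r where r: "supp_in r \<phi>" using test_function_supp_in[OF \<phi>] .
  note c\<phi> = test_function_continuous[OF \<phi>]
  note c\<psi> = test_function_continuous[OF test_function_partial_deriv[OF \<phi> b]]
  note s\<psi> = supp_in_partial_deriv[OF r, of b]
  have H: "0 \<le> ?H" using h by (intro integral_nonneg_AE) auto
  have \<Phi>: "0 \<le> \<Phi>" unfolding \<Phi>_def by (intro integral_nonneg_AE) auto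
  have i\<Phi>: "integrable lborel (\<lambda>x. (\<phi> x)\<^sup>2)"
    using r by (intro continuous_supp_in_integrable[of _ r] continuous_intros c\<phi>) (auto simp: supp_in_def)
  have main: "\<bar>\<integral>x. u x * ?\<psi> x \<partial>lborel\<bar> \<le> 4 * \<tau>" if \<tau>: "0 < \<tau>" for \<tau>
  proof -
    define s where "s = (\<Phi> + 1) / \<tau>"
    have s: "0 < s" "\<Phi> / s \<le> \<tau>" using \<Phi> \<tau> by (auto simp: s_def field_simps)
    define \<theta> where "\<theta> = \<tau> / (s * 4 * (A + ?H + 1))"
    have AH: "0 < A + ?H + 1" using A H by linarith
    have \<theta>: "0 < \<theta>" using s \<tau> AH by (simp add: \<theta>_def)
    have \<theta>s: "s * (4 * \<theta> * (A + ?H)) \<le> \<tau>"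
    proof -
      have "s * (4 * \<theta> * (A + ?H)) \<le> s * (4 * \<theta> * (A + ?H + 1))"
        using s \<theta> by (intro mult_left_mono) auto
      also have "\<dots> = \<tau>" using s AH by (simp add: \<theta>_def)
      finally show ?thesis .
    qed
    obtain \<eta> :: "real ^ 2 \<Rightarrow> real" and R g where \<eta>: "continuous_on UNIV \<eta>" "supp_in R \<eta>"
        "\<And>x. 0 \<le> \<eta> x" "\<And>x. \<eta> x \<le> 1" "\<And>x. norm x \<le> r \<Longrightarrow> 1 / 2 \<le> \<eta> x"
      and g: "\<And>b. continuous_on UNIV (g b)"
        "\<And>b. deriv_along b (\<lambda>x. (\<eta> x)\<^sup>2) (\<lambda>x. 2 * \<eta> x * g b x)"
      and G: "\<And>x. (\<Sum>b\<in>Basis. (g b x)\<^sup>2) \<le> \<theta>"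
        "(\<integral>x. indicator (cball 0 R) x * (\<Sum>b\<in>Basis. (g b x)\<^sup>2) \<partial>lborel) \<le> \<theta>"
    proof (rule planar_cutoff_exists[OF \<theta>, where r = r], goal_cases)
      case (1 \<eta> R g)
      show ?case by (rule 1(1)[OF 1(2-10)])
    qed
    let ?K = "A * measure lborel (cball 0 R :: (real^2) set) + ?H"
    have K: "0 \<le> ?K" using A H by simp
    define \<delta> where "\<delta> = \<tau> / (2 * s * (?K + 1))"
    have \<delta>: "0 < \<delta>" using s \<tau> K by (simp add: \<delta>_def)
    have \<delta>s: "s * (2 * \<delta> * ?K) \<le> \<tau>"
    proof -
      have "s * (2 * \<delta> * ?K) \<le> s * (2 * \<delta> * (?K + 1))"
        using s \<delta> by (intro mult_left_mono) auto
      also have "\<dots> = \<tau>" using s K by (simp add: \<delta>_def)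
      finally show ?thesis .
    qed
    have "uniformly_continuous_on (cball 0 (R + 1)) V"
      using V(1) by (intro compact_uniformly_continuous) (auto intro: continuous_on_subset)
    then obtain d where d: "0 < d"
      "\<And>x y. norm x \<le> R + 1 \<Longrightarrow> norm y \<le> R + 1 \<Longrightarrow> norm (y - x) < d \<Longrightarrow> \<bar>V y - V x\<bar> < \<delta>"
      using \<delta> unfolding uniformly_continuous_on_def dist_norm by (auto simp: norm_minus_commute)
    obtain \<epsilon>0 where \<epsilon>0: "0 < \<epsilon>0" "\<And>\<epsilon> \<rho>. \<epsilon> \<le> \<epsilon>0 \<Longrightarrow> mollifier \<epsilon> \<rho> \<Longrightarrow>
        \<bar>(\<integral>x. conv \<rho> u x * ?\<psi> x \<partial>lborel) - (\<integral>x. u x * ?\<psi> x \<partial>lborel)\<bar> \<le> \<tau>"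
      using conv_weak_limit[OF c\<psi> s\<psi> u(1) \<tau>] by blast
    define \<epsilon> where "\<epsilon> = min \<epsilon>0 (min 1 (d / 2))"
    have \<epsilon>: "0 < \<epsilon>" "\<epsilon> \<le> \<epsilon>0" "\<epsilon> \<le> 1" "\<epsilon> < d" using \<epsilon>0(1) d(1) by (auto simp: \<epsilon>_def)
    obtain \<rho> :: "real^2 \<Rightarrow> real" where \<rho>: "mollifier \<epsilon> \<rho>" using mollifier_exists[OF \<epsilon>(1)] by blast
    note \<rho>D = mollifierD[OF \<rho>]
    define p where "p = (\<lambda>b. conv (partial_deriv b \<rho>) u)"
    have osc: "\<bar>V y - V x\<bar> \<le> \<delta>" if "norm x \<le> R" "norm (x - y) \<le> \<epsilon>" for x y
    proof (rule less_imp_le, rule d(2))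
      show "norm y \<le> R + 1" using that \<epsilon>(3) norm_triangle_ineq2[of y x] by (simp add: norm_minus_commute)
      show "norm (y - x) < d" using that \<epsilon>(4) by (simp add: norm_minus_commute)
    qed (use that in simp)
    have "(1 / 2) * (\<integral>x. (\<eta> x)\<^sup>2 * (\<Sum>b\<in>Basis. (p b x)\<^sup>2) \<partial>lborel) \<le> 2 * \<theta> * (A + ?H) + \<delta> * ?K"
      unfolding p_def
      by (rule mollified_energy_bound[OF weak u h A V \<rho> osc \<eta>(1-4) g G less_imp_le[OF \<delta>]])
    hence "s * (\<integral>x. (\<eta> x)\<^sup>2 * (\<Sum>b\<in>Basis. (p b x)\<^sup>2) \<partial>lborel)
        \<le> s * (2 * (2 * \<theta> * (A + ?H) + \<delta> * ?K))"
      using s(1) by (intro mult_left_mono) auto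
    also have "\<dots> = s * (4 * \<theta> * (A + ?H)) + s * (2 * \<delta> * ?K)" by (simp add: algebra_simps)
    also have "\<dots> \<le> 2 * \<tau>" using \<theta>s \<delta>s by linarith
    finally have E: "s * (\<integral>x. (\<eta> x)\<^sup>2 * (\<Sum>b\<in>Basis. (p b x)\<^sup>2) \<partial>lborel) \<le> 2 * \<tau>" .
    have pc: "continuous_on UNIV (p b)" if "b \<in> Basis" for b
      unfolding p_def using test_function_continuous[OF test_function_partial_deriv[OF \<rho>D(1) that]]
      by (intro conv_continuous[OF u(1) _ supp_in_partial_deriv[OF \<rho>D(2)]])
    have wc: "continuous_on UNIV (conv \<rho> u)" by (intro conv_continuous[OF u(1) \<rho>D(4,2)])
    have wd: "deriv_along b (conv \<rho> u) (p b)"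
      unfolding p_def using test_function_continuous[OF test_function_partial_deriv[OF \<rho>D(1) b]]
      by (intro conv_deriv_along[OF u(1) \<rho>D(4,2)] supp_in_partial_deriv \<rho>D(2)
          test_function_deriv_along \<rho>D(1))
    have parts: "(\<integral>x. conv \<rho> u x * ?\<psi> x \<partial>lborel) = - (\<integral>x. p b x * \<phi> x \<partial>lborel)"
    proof -
      have i: "integrable lborel (\<lambda>x. p b x * \<phi> x)" "integrable lborel (\<lambda>x. conv \<rho> u x * ?\<psi> x)"
        using r s\<psi> by (auto intro!: continuous_supp_in_integrable[of _ r] continuous_intros c\<phi> c\<psi> pc b wc
            simp: supp_in_def)
      have "(\<integral>x. p b x * \<phi> x + conv \<rho> u x * ?\<psi> x \<partial>lborel) = 0"
        by (rule integral_deriv_along_eq_0[where k = "\<lambda>x. conv \<rho> u x * \<phi> x" and R = r and v = b])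
           (use r s\<psi> in \<open>auto intro!: continuous_intros c\<phi> c\<psi> pc b wc deriv_along_mult wd
             test_function_deriv_along \<phi> simp: supp_in_def\<close>)
      thus ?thesis using i by simp
    qed
    have "\<bar>\<integral>x. p b x * \<phi> x \<partial>lborel\<bar>
        \<le> (\<integral>x. s * ((\<eta> x)\<^sup>2 * (\<Sum>b\<in>Basis. (p b x)\<^sup>2)) + (1 / s) * (\<phi> x)\<^sup>2 \<partial>lborel)"
    proof (rule abs_integral_le)
      have "integrable lborel (\<lambda>x. (\<eta> x)\<^sup>2 * (\<Sum>b\<in>Basis. (p b x)\<^sup>2))"
        by (intro continuous_supp_in_integrable[of _ R] continuous_intros \<eta>(1) pc)
          (use \<eta>(2) in \<open>auto simp: supp_in_def\<close>)
      thus "integrable lborel (\<lambda>x. s * ((\<eta> x)\<^sup>2 * (\<Sum>b\<in>Basis. (p b x)\<^sup>2)) + (1 / s) * (\<phi> x)\<^sup>2)"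
        using i\<Phi> by simp
      fix x
      let ?P = "\<Sum>b\<in>Basis. (p b x)\<^sup>2"
      have P: "(p b x)\<^sup>2 \<le> ?P" by (rule member_le_sum[OF b]) auto
      show "\<bar>p b x * \<phi> x\<bar> \<le> s * ((\<eta> x)\<^sup>2 * ?P) + (1 / s) * (\<phi> x)\<^sup>2"
      proof (cases "\<phi> x = 0")
        case False
        hence "norm x \<le> r" using r by (auto simp: supp_in_def not_less[symmetric])
        hence "(1 / 2)\<^sup>2 \<le> (\<eta> x)\<^sup>2" using \<eta>(5) by (intro power_mono) auto
        hence "(1 / 4) * (p b x)\<^sup>2 \<le> (\<eta> x)\<^sup>2 * ?P"
          using P by (intro mult_mono) (auto simp: power2_eq_square)
        hence 1: "s * ((1 / 4) * (p b x)\<^sup>2) \<le> s * ((\<eta> x)\<^sup>2 * ?P)" using s by (intro mult_left_mono) auto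
        \<comment> \<open>Young's inequality with the weight \<open>s / 4\<close>, since \<open>\<eta> \<ge> 1 / 2\<close> on the support of \<open>\<phi>\<close>.\<close>
        have "0 \<le> (1 / s) * (s / 2 * \<bar>p b x\<bar> - \<bar>\<phi> x\<bar>)\<^sup>2" using s by simp
        also have "\<dots> = s * ((1 / 4) * (p b x)\<^sup>2) - \<bar>p b x\<bar> * \<bar>\<phi> x\<bar> + (1 / s) * (\<phi> x)\<^sup>2"
          using s by (simp add: power2_diff power_mult_distrib power2_eq_square[of s] field_simps)
        finally show ?thesis using 1 by (simp add: abs_mult)
      qed (use s in \<open>auto intro!: mult_nonneg_nonneg sum_nonneg\<close>)
    qed
    also have "\<dots> = s * (\<integral>x. (\<eta> x)\<^sup>2 * (\<Sum>b\<in>Basis. (p b x)\<^sup>2) \<partial>lborel) + \<Phi> / s"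
    proof -
      have "integrable lborel (\<lambda>x. (\<eta> x)\<^sup>2 * (\<Sum>b\<in>Basis. (p b x)\<^sup>2))"
        by (intro continuous_supp_in_integrable[of _ R] continuous_intros \<eta>(1) pc)
          (use \<eta>(2) in \<open>auto simp: supp_in_def\<close>)
      thus ?thesis using i\<Phi> by (simp add: \<Phi>_def)
    qed
    also have "\<dots> \<le> 3 * \<tau>" using E s(2) by linarith
    finally have "\<bar>\<integral>x. conv \<rho> u x * ?\<psi> x \<partial>lborel\<bar> \<le> 3 * \<tau>" unfolding parts by simp
    thus ?thesis using \<epsilon>0(2)[OF \<epsilon>(2) \<rho>] by linarith
  qed
  have "\<bar>\<integral>x. u x * ?\<psi> x \<partial>lborel\<bar> \<le> 0"
  proof (rule field_le_epsilon)
    fix e :: real assume "0 < e"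
    thus "\<bar>\<integral>x. u x * ?\<psi> x \<partial>lborel\<bar> \<le> 0 + e" using main[of "e / 4"] by simp
  qed
  thus ?thesis by simp
qed

section \<open>Functions with vanishing weak gradient\<close>

lemma conv_translation_invariant:
  fixes u :: "'a::euclidean_space \<Rightarrow> real"
  assumes u: "loc_int u" and \<phi>: "test_function \<phi>"
    and grad: "\<And>\<phi> b. test_function \<phi> \<Longrightarrow> b \<in> Basis \<Longrightarrow> (\<integral>x. u x * partial_deriv b \<phi> x \<partial>lborel) = 0"
  shows "conv \<phi> u x = conv \<phi> u 0"
proof -
  let ?k = "\<lambda>z. \<Sum>b\<in>Basis. (x \<bullet> b) * partial_deriv b \<phi> z"
  obtain r where r: "supp_in r \<phi>" using test_function_supp_in[OF \<phi>] .
  note c = test_function_continuous[OF test_function_partial_deriv[OF \<phi>]]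
  have z: "conv (partial_deriv b \<phi>) u y = 0" if "b \<in> Basis" for b y
  proof -
    have "partial_deriv b (\<lambda>z. \<phi> (y - z)) = (\<lambda>z. - partial_deriv b \<phi> (y - z))"
      using partial_deriv_reflect[of \<phi> b 1 y] test_function_differentiable[OF \<phi>] by simp
    thus ?thesis using grad[OF test_function_reflect[OF \<phi>, of y] that]
      by (simp add: conv_def mult.commute)
  qed
  have k0: "conv ?k u y = 0" for y
  proof -
    have "conv ?k u y = (\<integral>z. (\<Sum>b\<in>Basis. (x \<bullet> b) * (partial_deriv b \<phi> (y - z) * u z)) \<partial>lborel)"
      by (simp add: conv_def sum_distrib_right mult.assoc)
    also have "\<dots> = (\<Sum>b\<in>Basis. (x \<bullet> b) * conv (partial_deriv b \<phi>) u y)"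
      unfolding conv_def
      by (subst Bochner_Integration.integral_sum)
        (auto intro!: integrable_mult_right conv_integrable[OF u _ supp_in_partial_deriv[OF r]] c)
    finally show ?thesis using z by simp
  qed
  have "deriv_along x (conv \<phi> u) (conv ?k u)"
  proof (rule conv_deriv_along[OF u test_function_continuous[OF \<phi>] r])
    show "continuous_on UNIV ?k" by (intro continuous_intros c)
    show "supp_in r ?k"
      using supp_in_partial_deriv[OF r] by (auto simp: supp_in_def intro!: sum.neutral)
  qed (rule test_function_deriv_along_sum[OF \<phi>])
  hence "\<bar>conv \<phi> u (0 + 1 *\<^sub>R x) - conv \<phi> u 0\<bar> \<le> 0 * \<bar>1\<bar>"
    by (rule deriv_along_bound) (simp add: k0)
  thus ?thesis by simp
qed

lemma box_bump_tendsto: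
  assumes "0 < r"
  shows "(\<lambda>n. box_bump (1 / real (Suc n)) r z)
    \<longlonglongrightarrow> (if \<forall>b\<in>Basis. \<bar>z \<bullet> b\<bar> < r then 1 else 0)"
proof (cases "\<forall>b\<in>Basis. \<bar>z \<bullet> b\<bar> < r")
  case True
  have "(\<lambda>n. \<Prod>b\<in>Basis. bump_family (1 / real (Suc n)) 1 0 (z \<bullet> b / r)) \<longlonglongrightarrow> (\<Prod>b\<in>(Basis::'a set). 1)"
  proof (rule tendsto_prod)
    fix b :: 'a assume b: "b \<in> Basis"
    hence lt: "\<bar>z \<bullet> b / r\<bar> < 1" using True assms by (simp add: abs_divide)
    have "(\<lambda>n. exp (- (1 / real (Suc n)) / (1 - (z \<bullet> b / r)\<^sup>2))) \<longlonglongrightarrow> exp (- 0 / (1 - (z \<bullet> b / r)\<^sup>2))"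
      using abs_square_less_1[THEN iffD2, OF lt] LIMSEQ_inverse_real_of_nat
      by (intro tendsto_intros) (auto simp: inverse_eq_divide)
    thus "(\<lambda>n. bump_family (1 / real (Suc n)) 1 0 (z \<bullet> b / r)) \<longlonglongrightarrow> 1"
      using lt by (simp add: bump_family_def)
  qed
  thus ?thesis using True by (simp add: box_bump_def)
next
  case False
  then obtain b where "b \<in> Basis" "r \<le> \<bar>z \<bullet> b\<bar>" by (auto simp: not_less)
  hence "(\<lambda>n. box_bump (1 / real (Suc n)) r z) = (\<lambda>_. 0)" using box_bump_eq_0[OF assms] by auto
  thus ?thesis using False by (simp only: if_False tendsto_const)
qed

text \<open>The smooth bumps increase to the indicator of the cube as their exponent tends to zero, so the
  translation invariance of smooth averages passes to averages over cubes.\<close>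

lemma cube_integral_translation_invariant:
  fixes u :: "'a::euclidean_space \<Rightarrow> real"
  assumes u: "loc_int u" and "0 < r"
    and grad: "\<And>\<phi> b. test_function \<phi> \<Longrightarrow> b \<in> Basis \<Longrightarrow> (\<integral>x. u x * partial_deriv b \<phi> x \<partial>lborel) = 0"
  shows "(\<integral>y. indicator (box (x - r *\<^sub>R One) (x + r *\<^sub>R One)) y * u y \<partial>lborel)
    = (\<integral>y. indicator (box (- r *\<^sub>R One) (r *\<^sub>R One)) y * u y \<partial>lborel)"
proof -
  have um: "u \<in> borel_measurable borel" using u by (simp add: loc_int_def)
  have lim: "(\<lambda>n. conv (box_bump (1 / real (Suc n)) r) u x)
      \<longlonglongrightarrow> (\<integral>y. indicator (box (x - r *\<^sub>R One) (x + r *\<^sub>R One)) y * u y \<partial>lborel)" for x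
    unfolding conv_def
  proof (rule integral_dominated_convergence)
    let ?S = "r * DIM('a) + norm x"
    show "integrable lborel (\<lambda>y. \<bar>indicator (cball 0 ?S) y * u y\<bar>)"
      using u by (intro integrable_abs) (auto simp: loc_int_def)
    show "(\<lambda>y. indicator (box (x - r *\<^sub>R One) (x + r *\<^sub>R One)) y * u y) \<in> borel_measurable lborel"
      using um by simp
    show "(\<lambda>y. box_bump (1 / real (Suc n)) r (x - y) * u y) \<in> borel_measurable lborel" for n
      using test_function_continuous[OF test_function_box_bump[of "1 / real (Suc n)" r 1]] assms(2)
      by (intro conv_measurable_integrand[OF u]) auto
    show "AE y in lborel. (\<lambda>n. box_bump (1 / real (Suc n)) r (x - y) * u y)
        \<longlonglongrightarrow> indicator (box (x - r *\<^sub>R One) (x + r *\<^sub>R One)) y * u y"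
    proof (intro AE_I2 tendsto_mult tendsto_const)
      fix y
      have "(y \<in> box (x - r *\<^sub>R One) (x + r *\<^sub>R One)) = (\<forall>b\<in>Basis. \<bar>(x - y) \<bullet> b\<bar> < r)"
        by (auto simp: mem_box inner_diff_left inner_add_left abs_less_iff)
      hence "indicator (box (x - r *\<^sub>R One) (x + r *\<^sub>R One)) y
          = (if \<forall>b\<in>Basis. \<bar>(x - y) \<bullet> b\<bar> < r then 1 else 0 :: real)"
        by (simp only: indicator_def of_bool_def)
      thus "(\<lambda>n. box_bump (1 / real (Suc n)) r (x - y))
          \<longlonglongrightarrow> indicator (box (x - r *\<^sub>R One) (x + r *\<^sub>R One)) y"
        using box_bump_tendsto[OF assms(2), of "x - y"] by (simp only:)
    qed
    show "AE y in lborel. norm (box_bump (1 / real (Suc n)) r (x - y) * u y)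
        \<le> \<bar>indicator (cball 0 ?S) y * u y\<bar>" for n
    proof (rule AE_I2)
      fix y
      let ?B = "box_bump (1 / real (Suc n)) r (x - y)"
      have "\<bar>?B\<bar> \<le> indicator (cball 0 ?S) y"
      proof (cases "norm y \<le> ?S")
        case True
        thus ?thesis using box_bump_nonneg[of "1 / real (Suc n)" r "x - y"]
            box_bump_le_1[of "1 / real (Suc n)" r "x - y"] by simp
      next
        case False
        thus ?thesis
          using supp_in_reflect[OF supp_in_box_bump[OF assms(2)], of x "1 / real (Suc n)"]
          by (simp add: supp_in_def)
      qed
      from mult_right_mono[OF this abs_ge_zero[of "u y"]]
      show "norm (?B * u y) \<le> \<bar>indicator (cball 0 ?S) y * u y\<bar>" by (simp add: abs_mult)
    qed
  qed
  have "conv (box_bump (1 / real (Suc n)) r) u x = conv (box_bump (1 / real (Suc n)) r) u 0" for n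
    using test_function_box_bump[of "1 / real (Suc n)" r 1] assms(2)
    by (intro conv_translation_invariant[OF u _ grad]) auto
  hence "(\<lambda>n. conv (box_bump (1 / real (Suc n)) r) u 0)
      \<longlonglongrightarrow> (\<integral>y. indicator (box (x - r *\<^sub>R One) (x + r *\<^sub>R One)) y * u y \<partial>lborel)"
    using lim[of x] by simp
  from LIMSEQ_unique[OF this lim[of 0]] show ?thesis by simp
qed

text \<open>By Lebesgue's differentiation theorem, almost every value of \<open>u\<close> is the limit of averages over
  shrinking cubes, and these averages are the same at all points.\<close>

lemma vanishing_gradient_imp_constant:
  fixes u :: "'a::euclidean_space \<Rightarrow> real"
  assumes u: "loc_int u"
    and grad: "\<And>\<phi> b. test_function \<phi> \<Longrightarrow> b \<in> Basis \<Longrightarrow> (\<integral>x. u x * partial_deriv b \<phi> x \<partial>lborel) = 0"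
  shows "\<exists>k. AE x in lebesgue. u x = k"
proof -
  have si: "set_integrable lborel S u" if S: "S \<in> sets borel" "bounded S" for S
  proof -
    obtain B where "\<forall>x\<in>S. norm x \<le> B" using S(2) bounded_iff by blast
    then obtain R where R: "S \<subseteq> cball 0 R" by (auto simp: subset_iff)
    have "set_integrable lborel (cball 0 R) u" using u by (simp add: loc_int_def set_integrable_def)
    thus ?thesis by (rule set_integrable_subset) (use S R in auto)
  qed
  have iu: "u integrable_on cbox a b" for a b
    using si[of "cbox a b"] by (intro set_borel_integral_eq_integral(1)) auto
  define J where "J = (\<lambda>r. \<integral>y. indicator (box (- r *\<^sub>R One) (r *\<^sub>R One)) y * u y \<partial>lborel)"
  have cube: "integral (cbox x (x + h *\<^sub>R One)) u = J (h / 2)" if h: "0 < h" for x h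
  proof -
    \<comment> \<open>The differentiation theorem uses cubes with corner \<open>x\<close>; they are centred at \<open>?x\<close>.\<close>
    let ?x = "x + (h / 2) *\<^sub>R One"
    have e: "box x (x + h *\<^sub>R One) = box (?x - (h / 2) *\<^sub>R One) (?x + (h / 2) *\<^sub>R One)"
      by (simp add: add.assoc scaleR_add_left[symmetric])
    have "integral (cbox x (x + h *\<^sub>R One)) u = integral (box x (x + h *\<^sub>R One)) u"
      by (rule integral_open_interval[symmetric])
    also have "\<dots> = (LINT y:box x (x + h *\<^sub>R One)|lborel. u y)"
      using si[of "box x (x + h *\<^sub>R One)"] by (intro set_borel_integral_eq_integral(2)[symmetric]) auto
    also have "\<dots> = J (h / 2)"
      unfolding e J_def using cube_integral_translation_invariant[OF u _ grad, of "h / 2" ?x] h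
      by (simp add: set_lebesgue_integral_def)
    finally show ?thesis .
  qed
  obtain N where N: "negligible N"
    "\<And>x e. \<lbrakk>x \<notin> N; 0 < e\<rbrakk> \<Longrightarrow> \<exists>d>0. \<forall>h. 0 < h \<and> h < d \<longrightarrow>
        norm (integral (cbox x (x + h *\<^sub>R One)) u /\<^sub>R h ^ DIM('a) - u x) < e"
    using integrable_ccontinuous_explicit[OF iu] by metis
  have eq: "u x = u y" if xy: "x \<notin> N" "y \<notin> N" for x y
  proof (rule ccontr)
    assume "u x \<noteq> u y"
    define e where "e = \<bar>u x - u y\<bar> / 2"
    have e: "0 < e" using \<open>u x \<noteq> u y\<close> by (simp add: e_def)
    obtain d1 d2 where d: "0 < d1" "0 < d2"
      "\<And>h. 0 < h \<Longrightarrow> h < d1 \<Longrightarrow> \<bar>J (h / 2) /\<^sub>R h ^ DIM('a) - u x\<bar> < e"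
      "\<And>h. 0 < h \<Longrightarrow> h < d2 \<Longrightarrow> \<bar>J (h / 2) /\<^sub>R h ^ DIM('a) - u y\<bar> < e"
      using N(2)[OF xy(1) e] N(2)[OF xy(2) e] cube by auto
    define h where "h = min d1 d2 / 2"
    have "0 < h" "h < d1" "h < d2" using d by (auto simp: h_def)
    hence "\<bar>u x - u y\<bar> < 2 * e" using d(3)[of h] d(4)[of h] by linarith
    thus False by (simp add: e_def)
  qed
  have "N \<noteq> UNIV" using N(1) by auto
  then obtain x0 where "x0 \<notin> N" by blast
  have "AE x in lebesgue. x \<notin> N"
    using N(1) by (intro AE_not_in) (simp add: negligible_iff_null_sets)
  hence "AE x in lebesgue. u x = u x0" by eventually_elim (rule eq[OF _ \<open>x0 \<notin> N\<close>])
  thus ?thesis by blast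
qed

section \<open>Absence of a zero resonance\<close>

lemma loc_int_of_square_bound:
  fixes u :: "'a::euclidean_space \<Rightarrow> real"
  assumes u: "u \<in> borel_measurable borel" "\<And>x. (u x)\<^sup>2 \<le> A + h x" and h: "integrable lborel h"
  shows "loc_int u"
proof (rule loc_int_bound[OF loc_int_add[OF loc_int_continuous[of "\<lambda>_. A + 1"] loc_int_integrable[OF h]] u(1)])
  fix x
  have "0 \<le> (\<bar>u x\<bar> - 1)\<^sup>2" by simp
  hence "2 * \<bar>u x\<bar> \<le> (u x)\<^sup>2 + 1" by (simp add: power2_diff)
  thus "\<bar>u x\<bar> \<le> A + 1 + h x" using u(2)[of x] abs_ge_zero[of "u x"] by linarith
qed (intro continuous_intros)

text \<open>Once \<open>u\<close> is a constant \<open>k\<close>, testing with a bump around a point where \<open>V\<close> is positive gives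
  \<open>k \<integral>\<phi> V = k \<integral>\<Delta>\<phi> = 0\<close>.\<close>

lemma weak_solution_zero:
  fixes u V h :: "real ^ 2 \<Rightarrow> real"
  assumes weak: "\<And>\<phi>. test_function \<phi> \<Longrightarrow>
      (\<integral>y. laplacian \<phi> y * u y \<partial>lborel) = (\<integral>y. \<phi> y * (V y * u y) \<partial>lborel)"
    and u: "u \<in> borel_measurable borel" "\<And>x. (u x)\<^sup>2 \<le> A + h x"
    and h: "integrable lborel h" "\<And>x. 0 \<le> h x" and A: "0 \<le> A"
    and V: "continuous_on UNIV V" "\<And>x. 0 \<le> V x" "V x0 \<noteq> 0"
  shows "AE x in lebesgue. u x = 0"
proof -
  have lu: "loc_int u" by (rule loc_int_of_square_bound[OF u h(1)])
  obtain k where k: "AE x in lebesgue. u x = k"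
    using vanishing_gradient_imp_constant[OF lu test_gradient_vanishes[OF weak lu u(2) h A V(1,2)]] by blast
  hence kb: "AE x in lborel. u x = k" by (simp only: AE_completion_iff)
  define \<phi> :: "real^2 \<Rightarrow> real" where "\<phi> = (\<lambda>y. box_bump 1 1 (x0 - y))"
  have \<phi>: "test_function \<phi>"
    unfolding \<phi>_def using test_function_box_bump[of 1 1 1] by (intro test_function_reflect) simp
  obtain r where r: "supp_in r \<phi>" using test_function_supp_in[OF \<phi>] .
  note c\<phi> = test_function_continuous[OF \<phi>]
  have d0: "(\<integral>y. laplacian \<phi> y \<partial>lborel) = 0"
  proof -
    have *: "integrable lborel (partial_deriv b (partial_deriv b \<phi>)) \<and>
        (\<integral>y. partial_deriv b (partial_deriv b \<phi>) y \<partial>lborel) = 0" if b: "b \<in> Basis" for b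
    proof -
      note t = test_function_partial_deriv[OF \<phi> b] test_function_partial_deriv[OF test_function_partial_deriv[OF \<phi> b] b]
      note sp = supp_in_partial_deriv[OF r, of b] supp_in_partial_deriv[OF supp_in_partial_deriv[OF r, of b], of b]
      show ?thesis
        using continuous_supp_in_integrable[OF test_function_continuous[OF t(2)] sp(2)]
          integral_deriv_along_eq_0[OF test_function_continuous[OF t(1)] sp(1)
            test_function_continuous[OF t(2)] sp(2) test_function_deriv_along[OF t(1)]] by blast
    qed
    thus ?thesis by (simp add: laplacian_def)
  qed
  have cl: "continuous_on UNIV (laplacian \<phi>)"
    unfolding laplacian_def[abs_def]
    by (intro continuous_intros test_function_continuous test_function_partial_deriv \<phi>)
  have cong: "(\<integral>y. f y * u y \<partial>lborel) = (\<integral>y. f y * k \<partial>lborel)" if "continuous_on UNIV f" for f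
  proof (rule integral_cong_AE)
    have f: "f \<in> borel_measurable lborel" using borel_measurable_continuous_onI[OF that] by simp
    show "(\<lambda>y. f y * u y) \<in> borel_measurable lborel" "(\<lambda>y. f y * k) \<in> borel_measurable lborel"
      using f u(1) by (auto intro!: borel_measurable_times)
    show "AE y in lborel. f y * u y = f y * k" using kb by eventually_elim simp
  qed
  from cong[OF cl] have 1: "(\<integral>y. \<phi> y * (V y * u y) \<partial>lborel) = 0" using weak[OF \<phi>] d0 by simp
  have "(\<integral>y. \<phi> y * (V y * u y) \<partial>lborel) = (\<integral>y. (\<phi> y * V y) * k \<partial>lborel)"
    using cong[of "\<lambda>y. \<phi> y * V y"] by (simp add: mult.assoc continuous_on_mult c\<phi> V)
  hence "(\<integral>y. \<phi> y * V y \<partial>lborel) * k = 0" using 1 by simp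
  moreover have "0 < (\<integral>y. \<phi> y * V y \<partial>lborel)"
  proof (rule integral_continuous_pos[of _ r x0])
    have "0 < (box_bump 1 1 (0 :: real^2) :: real)"
      by (auto simp: box_bump_def bump_family_def intro!: prod_pos)
    thus "0 < \<phi> x0 * V x0" using V(2)[of x0] V(3) by (simp add: \<phi>_def less_le)
    show "supp_in r (\<lambda>y. \<phi> y * V y)" using r by (simp add: supp_in_def)
    show "0 \<le> \<phi> y * V y" for y unfolding \<phi>_def by (intro mult_nonneg_nonneg V box_bump_nonneg)
  qed (intro continuous_intros c\<phi> V)
  ultimately have "k = 0" by simp
  thus ?thesis using k by simp
qed


text \<open>To be applied to \<open>T = Re\<close> and \<open>T = Im\<close>. The square of the component is dominated by a constant plus
  \<open>2 \<bar>\<Psi>\<^sub>0\<bar>\<^sup>q\<close>, because \<open>t\<^sup>2 \<le> 1 + t\<^sup>q\<close> for \<open>q > 2\<close>. The integrable part \<open>h\<close> is defined from a Borel representative \<open>u\<close> of the component so that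
  the bound holds at every point.\<close>

lemma solution_component_zero:
  fixes V :: "real ^ 2 \<Rightarrow> real" and T :: "complex \<Rightarrow> real"
  assumes V: "continuous_on UNIV V" "\<And>x. 0 \<le> V x" "V x0 \<noteq> 0"
    and q: "2 < q" and \<Psi>0: "in_Lp q \<Psi>0" and sol: "schrodinger_solution V (\<lambda>x. c0 + \<Psi>0 x)"
    and T: "bounded_linear T" "\<And>z. \<bar>T z\<bar> \<le> norm z"
  shows "AE x in lebesgue. T (c0 + \<Psi>0 x) = 0"
proof -
  let ?\<Psi> = "\<lambda>x. c0 + \<Psi>0 x"
  have Tm: "T \<in> borel_measurable borel"
    using T(1) by (intro borel_measurable_continuous_onI linear_continuous_on)
  have \<Psi>m: "?\<Psi> \<in> borel_measurable lebesgue" using \<Psi>0 by (auto simp: in_Lp_def)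
  have TPm: "(\<lambda>x. T (?\<Psi> x)) \<in> borel_measurable lebesgue"
    by (rule measurable_compose[OF \<Psi>m Tm])
  obtain u where u: "u \<in> borel_measurable lborel" "AE x in lborel. T (?\<Psi> x) = u x"
    using completion_ex_borel_measurable_real[OF TPm] by blast
  have uL: "AE x in lebesgue. T (?\<Psi> x) = u x" using u(2) by (rule AE_completion)
  define A where "A = 2 * (norm c0)\<^sup>2 + 2"
  define h where "h = (\<lambda>x. max 0 ((u x)\<^sup>2 - A))"
  have bound: "(T (?\<Psi> x))\<^sup>2 \<le> A + 2 * norm (\<Psi>0 x) powr q" for x
  proof -
    have "\<bar>T (?\<Psi> x)\<bar>\<^sup>2 \<le> (norm c0 + norm (\<Psi>0 x))\<^sup>2"
      by (intro power_mono order.trans[OF T(2) norm_triangle_ineq]) auto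
    also have "\<dots> \<le> 2 * (norm c0)\<^sup>2 + 2 * (norm (\<Psi>0 x))\<^sup>2"
      using sum_squares_ge_zero[of "norm c0 - norm (\<Psi>0 x)" 0]
      by (simp add: power2_eq_square algebra_simps)
    also have "(norm (\<Psi>0 x))\<^sup>2 \<le> 1 + norm (\<Psi>0 x) powr q"
    proof (cases "norm (\<Psi>0 x) \<le> 1")
      case True
      hence "(norm (\<Psi>0 x))\<^sup>2 \<le> 1" by (simp add: power_le_one)
      thus ?thesis using powr_ge_zero[of "norm (\<Psi>0 x)" q] by linarith
    next
      case False
      hence "norm (\<Psi>0 x) powr 2 \<le> norm (\<Psi>0 x) powr q" using q by (intro powr_mono) auto
      thus ?thesis using False by (simp add: powr_numeral)
    qed
    finally show ?thesis by (simp add: A_def)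
  qed
  have hm: "h \<in> borel_measurable lborel" unfolding h_def using u(1) by measurable
  have "integrable lebesgue h"
  proof (rule Bochner_Integration.integrable_bound)
    show "integrable lebesgue (\<lambda>x. 2 * norm (\<Psi>0 x) powr q)" using \<Psi>0 by (simp add: in_Lp_def)
    show "h \<in> borel_measurable lebesgue" using hm by (rule measurable_completion)
    show "AE x in lebesgue. norm (h x) \<le> norm (2 * norm (\<Psi>0 x) powr q)"
      using uL
    proof eventually_elim
      case (elim x)
      have "(u x)\<^sup>2 \<le> A + 2 * norm (\<Psi>0 x) powr q" using bound[of x] elim by simp
      thus ?case by (simp add: h_def max_def)
    qed
  qed
  hence h: "integrable lborel h" using integrable_completion[OF hm] by blast
  have lu: "loc_int u"
    by (rule loc_int_of_square_bound[OF _ _ h, of _ A]) (use u(1) in \<open>auto simp: h_def\<close>)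
  have weak: "(\<integral>y. laplacian \<phi> y * u y \<partial>lborel) = (\<integral>y. \<phi> y * (V y * u y) \<partial>lborel)"
    if \<phi>: "test_function \<phi>" for \<phi>
  proof -
    obtain R where R: "supp_in R \<phi>" using test_function_supp_in[OF \<phi>] .
    have cl: "continuous_on UNIV (laplacian \<phi>)"
      unfolding laplacian_def[abs_def]
      by (intro continuous_intros test_function_continuous test_function_partial_deriv \<phi>)
    have sl: "supp_in R (laplacian \<phi>)"
      using supp_in_partial_deriv[OF supp_in_partial_deriv[OF R]]
      by (simp add: supp_in_def laplacian_def)
    define k where "k = (\<lambda>x. - laplacian \<phi> x + V x * \<phi> x)"
    have ck: "continuous_on UNIV k"
      unfolding k_def by (intro continuous_intros cl V test_function_continuous \<phi>)
    have sk: "supp_in R k" using sl R by (simp add: supp_in_def k_def)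
    have km: "k \<in> borel_measurable lborel" using borel_measurable_continuous_onI[OF ck] by simp
    obtain M where M: "0 \<le> M" "\<And>x. \<bar>k x\<bar> \<le> M" using continuous_supp_in_bounded[OF ck sk] by blast
    have int: "integrable lebesgue (\<lambda>x. k x *\<^sub>R ?\<Psi> x)"
    proof (rule Bochner_Integration.integrable_bound)
      show "integrable lebesgue (\<lambda>x. M *\<^sub>R (indicator (cball 0 R) x *\<^sub>R ?\<Psi> x))"
        using sol unfolding schrodinger_solution_def locally_integrable_def set_integrable_def
        by (intro integrable_scaleR_right) auto
      show "(\<lambda>x. k x *\<^sub>R ?\<Psi> x) \<in> borel_measurable lebesgue"
        using measurable_completion[OF km] \<Psi>m by measurable
      show "AE x in lebesgue. norm (k x *\<^sub>R ?\<Psi> x) \<le> norm (M *\<^sub>R (indicator (cball 0 R) x *\<^sub>R ?\<Psi> x))"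
      proof (rule AE_I2)
        fix x
        show "norm (k x *\<^sub>R ?\<Psi> x) \<le> norm (M *\<^sub>R (indicator (cball 0 R) x *\<^sub>R ?\<Psi> x))"
          using M sk by (cases "norm x \<le> R") (auto simp: supp_in_def intro!: mult_right_mono)
      qed
    qed
    have "T (\<integral>x. k x *\<^sub>R ?\<Psi> x \<partial>lebesgue) = T 0"
      using sol \<phi> unfolding schrodinger_solution_def k_def by simp
    hence "(\<integral>x. T (k x *\<^sub>R ?\<Psi> x) \<partial>lebesgue) = 0"
      using integral_bounded_linear[OF T(1) int] linear_0[OF bounded_linear.linear[OF T(1)]] by simp
    moreover have "(\<integral>x. T (k x *\<^sub>R ?\<Psi> x) \<partial>lebesgue) = (\<integral>x. k x * u x \<partial>lebesgue)"
    proof (rule integral_cong_AE)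
      show "(\<lambda>x. T (k x *\<^sub>R ?\<Psi> x)) \<in> borel_measurable lebesgue"
        by (rule measurable_compose[OF borel_measurable_integrable[OF int] Tm])
      show "(\<lambda>x. k x * u x) \<in> borel_measurable lebesgue"
        using measurable_completion[OF km] measurable_completion[OF u(1)] by measurable
      show "AE x in lebesgue. T (k x *\<^sub>R ?\<Psi> x) = k x * u x"
        using uL by eventually_elim (simp add: linear_scale[OF bounded_linear.linear[OF T(1)]])
    qed
    moreover have "(\<integral>x. k x * u x \<partial>lebesgue) = (\<integral>x. k x * u x \<partial>lborel)"
      using km u(1) by (intro integral_completion borel_measurable_times)
    ultimately have "(\<integral>x. k x * u x \<partial>lborel) = 0" by simp
    moreover have "(\<integral>x. k x * u x \<partial>lborel)
        = (\<integral>x. \<phi> x * (V x * u x) - laplacian \<phi> x * u x \<partial>lborel)"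
      by (intro Bochner_Integration.integral_cong refl) (simp add: k_def algebra_simps)
    moreover have "\<dots> = (\<integral>x. \<phi> x * (V x * u x) \<partial>lborel) - (\<integral>x. laplacian \<phi> x * u x \<partial>lborel)"
      by (intro Bochner_Integration.integral_diff
          continuous_mult_loc_int[OF loc_int_continuous_mult[OF lu V(1)] test_function_continuous[OF \<phi>] R]
          continuous_mult_loc_int[OF lu cl sl])
    ultimately show ?thesis by simp
  qed
  have "AE x in lebesgue. u x = 0"
    by (rule weak_solution_zero[OF weak _ _ h _ _ V, where A = A])
      (use u(1) in \<open>auto simp: h_def A_def\<close>)
  with uL show ?thesis by eventually_elim simp
qed

theorem mainTheorem6:
  fixes V :: "real ^ 2 \<Rightarrow> real" and gradV :: "real ^ 2 \<Rightarrow> real ^ 2" and c \<beta> :: real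
  assumes V_gradient: "\<And>x. GDERIV V x :> gradV x"
    and V_C1: "continuous_on UNIV gradV"
    and V_nontrivial: "\<exists>x. V x \<noteq> 0"
    and V_nonneg: "\<And>x. V x \<ge> 0"
    and c_pos: "c > 0"
    and beta: "\<beta> > 10"
    and V_decay: "\<And>x. \<bar>V x\<bar> + \<bar>x \<bullet> gradV x\<bar> \<le> c * japanese_bracket x powr (- \<beta>)"
  shows "\<not> zero_resonance V \<and>
    (\<forall>c\<^sub>0 \<Psi>\<^sub>0 q. 2 < q \<longrightarrow> in_Lp q \<Psi>\<^sub>0 \<longrightarrow>
       schrodinger_solution V (\<lambda>x. c\<^sub>0 + \<Psi>\<^sub>0 x) \<longrightarrow>
       (AE x in lebesgue. c\<^sub>0 + \<Psi>\<^sub>0 x = 0))"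
proof -
  have cV: "continuous_on UNIV V"
    using V_gradient unfolding gderiv_def
    by (intro continuous_at_imp_continuous_on ballI has_derivative_continuous) blast
  obtain x0 where x0: "V x0 \<noteq> 0" using V_nontrivial by blast
  have "AE x in lebesgue. c0 + \<Psi>0 x = 0"
    if "2 < q" "in_Lp q \<Psi>0" "schrodinger_solution V (\<lambda>x. c0 + \<Psi>0 x)" for c0 \<Psi>0 q
  proof -
    have "AE x in lebesgue. Re (c0 + \<Psi>0 x) = 0"
      by (rule solution_component_zero[OF cV V_nonneg x0 that bounded_linear_Re abs_Re_le_cmod])
    moreover have "AE x in lebesgue. Im (c0 + \<Psi>0 x) = 0"
      by (rule solution_component_zero[OF cV V_nonneg x0 that bounded_linear_Im abs_Im_le_cmod])
    ultimately show ?thesis by eventually_elim (simp add: complex_eq_iff)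
  qed
  thus ?thesis unfolding zero_resonance_def by blast
qed

end
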